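(* Fix a nonempty $S\subseteq[n]$ with $|S|=s$ and $Q\in\mathbb R^{q\times k_0}$. Suppose the model for $S$ does not include an intercept, i.e. $X_S=(X^{(i)})_{i\in S}\in\mathbb R^s$ and $f(Y)=\beta_SX_S+\varepsilon_S$ with $\beta_S\in\mathbb R^{k_0\times s}$ and Gaussian noise $\varepsilon_S\sim\mathcal N(0,\Gamma_S)$ independent of $X_S$. Assume that $$\max\Big\{\sup_{\|\theta\|_2=1}\mathbb E[\langle X_S,\theta\rangle^4]^{1/4},\ \big\|\,\|X_S\|_2\,\big\|_{\psi_2}\Big\}\le K<\infty$$ for some $K\ge1$, that $\Lambda_S=\mathbb E[X_SX_S^T]$ is invertible, that the covariance matrix $\Sigma_S=\mathrm{Cov}[X_S]$ is nonsingular, and that $Q\beta_S\neq0$ with $$\frac{\mathrm{tr}(Q\Gamma_SQ^T)}{\mathrm{tr}(Q\beta_S\beta_S^TQ^T)}\le M$$ for a constant $M$. Then there is a constant $C>0$, independent of $t$ and $k_0$ (it may depend on the law of $X_S$ and on $M$), such that for all sufficiently large $t$, with probability at least $1-t^{-2}$, $$\frac{\left|\mathrm{tr}\big(\widehat\Sigma_S(t)\widehat\beta_S(t)^TQ^TQ\widehat\beta_S(t)\big)-\mathrm{tr}\big(\Sigma_S\beta_S^TQ^TQ\beta_S\big)\right|}{\mathrm{tr}\big(\Sigma_S\beta_S^TQ^TQ\beta_S\big)}\ \le\ C\,\kappa(\Sigma_S)\sqrt{\frac{\log t}{t}},$$ where $\kappa(\Sigma_S)$ is the condition number of $\Sigm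a_S$.
   Context: Setting. $X^{(1)},\dots,X^{(n)}$ are real random variables and $f(Y)$ is an $\mathbb R^{k_0}$-valued random vector on a common probability space; $S\subseteq[n]=\{1,\dots,n\}$. For a random variable $W$ and $\alpha\ge1$, $\|W\|_{\psi_\alpha}=\inf\{C>0:\mathbb E[\exp(|W|^\alpha/C^\alpha)]\le2\}$. The condition number of a symmetric positive definite matrix is the ratio of its largest to its smallest eigenvalue. Estimators. From $t$ i.i.d. joint samples $(X^{(1)}_\ell,\dots,X^{(n)}_\ell,f(Y_\ell))$, $\ell\in[t]$, put $X_\ell|_S=(X^{(i)}_\ell)_{i\in S}\in\mathbb R^s$, let $Z_S$ be the $t\times s$ matrix with rows $X_\ell|_S^T$ (assumed throughout to have full column rank), $Z_S^\dagger=(Z_S^TZ_S)^{-1}Z_S^T$, and define $$\widehat\beta_S(t)=(f(Y_1),\dots,f(Y_t))(Z_S^\dagger)^T\in\mathbb R^{k_0\times s},\qquad \widehat x_S(t)=\frac1t\sum_{\ell\in[t]}X_\ell|_S,$$ $$\widehat\Sigma_S(t)=\frac1{t-1}\sum_{\ell\in[t]}(X_\ell|_S-\widehat x_S(t))(X_\ell|_S-\widehat x_S(t))^T .$$ *)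

theory Defs
  imports
    "HOL-Probability.Probability"
    "Jordan_Normal_Form.Spectral_Radius"
    "Jordan_Normal_Form.DL_Rank"
    "Jordan_Normal_Form.Gauss_Jordan_Elimination"
begin

text \<open>
  Matrices and vectors are those of \<^typ>\<open>real mat\<close> and \<^typ>\<open>real vec\<close>, whose dimensions are natural
  numbers, so that one can quantify over the dimension of the response inside a formula.
  The unqualified names below would otherwise refer to the type-indexed vectors of HOL-Analysis.
\<close>

hide_const (open) Finite_Cartesian_Product.vec Finite_Cartesian_Product.mat
  Finite_Cartesian_Product.row Finite_Cartesian_Product.rows
  Finite_Cartesian_Product.column Finite_Cartesian_Product.columns
  Finite_Cartesian_Product.transpose
no_notation Finite_Cartesian_Product.vec_nth (infixl \<open>$\<close> 90)
no_notation Inner_Product.real_inner_class.inner (infix \<open>\<bullet>\<close> 70)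

subsection \<open>Linear algebra\<close>

definition vnorm :: "real vec \<Rightarrow> real" where
  "vnorm v = sqrt (v \<bullet> v)"

definition mtrace :: "real mat \<Rightarrow> real" where
  "mtrace A = (\<Sum>i<dim_row A. A $$ (i, i))"

text \<open>A singular matrix gets the inverse zero.\<close>

definition minv :: "real mat \<Rightarrow> real mat" where
  "minv A = (case mat_inverse A of Some B \<Rightarrow> B | None \<Rightarrow> 0\<^sub>m (dim_col A) (dim_row A))"

definition left_pinv :: "real mat \<Rightarrow> real mat" where
  "left_pinv Z = minv (Z\<^sup>T * Z) * Z\<^sup>T"

definition full_column_rank :: "real mat \<Rightarrow> bool" where
  "full_column_rank A \<longleftrightarrow> vec_space.rank (dim_row A) A = dim_col A"

definition condition_number :: "real mat \<Rightarrow> real" where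
  "condition_number A = Max (spectrum A) / Min (spectrum A)"

subsection \<open>Random variables and random vectors\<close>

text \<open>
  The Orlicz norm takes values in \<^typ>\<open>ennreal\<close> and uses the nonnegative integral: a
  variable without any admissible constant has norm infinity.
\<close>

definition psi_norm :: "'w measure \<Rightarrow> real \<Rightarrow> ('w \<Rightarrow> real) \<Rightarrow> ennreal" where
  "psi_norm P \<alpha> W =
     Inf {ennreal C | C. C > 0 \<and>
       (\<integral>\<^sup>+\<omega>. ennreal (exp (\<bar>W \<omega>\<bar> powr \<alpha> / C powr \<alpha>)) \<partial>P) \<le> 2}"

text \<open>The univariate normal law with mean \<open>m\<close> and variance \<open>v\<close>, degenerate when \<open>v = 0\<close>.\<close>

definition normal_law :: "real \<Rightarrow> real \<Rightarrow> real measure" where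
  "normal_law m v =
     (if v = 0 then return borel m else density lborel (\<lambda>x. ennreal (normal_density m (sqrt v) x)))"

text \<open>
  The centred Gaussian law with covariance matrix \<open>\<Gamma>\<close>, possibly singular: every linear
  functional of the vector is univariate normal with the corresponding variance.
\<close>

definition centred_gaussian :: "'w measure \<Rightarrow> nat \<Rightarrow> (nat \<Rightarrow> 'w \<Rightarrow> real) \<Rightarrow> real mat \<Rightarrow> bool" where
  "centred_gaussian P k E \<Gamma> \<longleftrightarrow>
     \<Gamma> \<in> carrier_mat k k \<and> \<Gamma>\<^sup>T = \<Gamma> \<and> (\<forall>\<theta>\<in>carrier_vec k. 0 \<le> \<theta> \<bullet> (\<Gamma> *\<^sub>v \<theta>)) \<and>
     (\<forall>j<k. E j \<in> borel_measurable P) \<and>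
     (\<forall>\<theta>\<in>carrier_vec k.
        distr P borel (\<lambda>\<omega>. \<theta> \<bullet> vec k (\<lambda>j. E j \<omega>)) = normal_law 0 (\<theta> \<bullet> (\<Gamma> *\<^sub>v \<theta>)))"

text \<open>
  Random vectors are given by their coordinates. As a random element of the product space over
  an index set \<open>I\<close>, the vector is \<open>coords I X\<close>; as a column vector of dimension
  \<open>card I\<close>, it is \<open>sub_vec I\<close>, with the indices in increasing order.
\<close>

definition coords :: "nat set \<Rightarrow> (nat \<Rightarrow> 'w \<Rightarrow> real) \<Rightarrow> 'w \<Rightarrow> nat \<Rightarrow> real" where
  "coords I X \<omega> = (\<lambda>i\<in>I. X i \<omega>)"

definition coord_space :: "nat set \<Rightarrow> (nat \<Rightarrow> real) measure" where
  "coord_space I = (\<Pi>\<^sub>M i\<in>I. (borel :: real measure))"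

definition law :: "'w measure \<Rightarrow> nat set \<Rightarrow> (nat \<Rightarrow> 'w \<Rightarrow> real) \<Rightarrow> (nat \<Rightarrow> real) measure" where
  "law P I X = distr P (coord_space I) (coords I X)"

definition sub_vec :: "nat set \<Rightarrow> (nat \<Rightarrow> real) \<Rightarrow> real vec" where
  "sub_vec S x = vec (card S) (\<lambda>a. x (sorted_list_of_set S ! a))"

definition rv_sub :: "nat set \<Rightarrow> (nat \<Rightarrow> 'w \<Rightarrow> real) \<Rightarrow> 'w \<Rightarrow> real vec" where
  "rv_sub S X \<omega> = sub_vec S (\<lambda>i. X i \<omega>)"

definition second_moment_mat :: "'w measure \<Rightarrow> nat set \<Rightarrow> (nat \<Rightarrow> 'w \<Rightarrow> real) \<Rightarrow> real mat" where
  "second_moment_mat P S X =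
     mat (card S) (card S) (\<lambda>(a, b). \<integral>\<omega>. rv_sub S X \<omega> $ a * rv_sub S X \<omega> $ b \<partial>P)"

definition mean_vec :: "'w measure \<Rightarrow> nat set \<Rightarrow> (nat \<Rightarrow> 'w \<Rightarrow> real) \<Rightarrow> real vec" where
  "mean_vec P S X = vec (card S) (\<lambda>a. \<integral>\<omega>. rv_sub S X \<omega> $ a \<partial>P)"

definition cov_mat :: "'w measure \<Rightarrow> nat set \<Rightarrow> (nat \<Rightarrow> 'w \<Rightarrow> real) \<Rightarrow> real mat" where
  "cov_mat P S X =
     mat (card S) (card S) (\<lambda>(a, b).
       \<integral>\<omega>. (rv_sub S X \<omega> - mean_vec P S X) $ a * (rv_sub S X \<omega> - mean_vec P S X) $ b \<partial>P)"

text \<open>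
  If a fourth moment were infinite, the Bochner integral below would be zero; but then the Orlicz
  norm is infinite as well, so that the maximum is not affected.
\<close>

definition moment_bound :: "'w measure \<Rightarrow> nat set \<Rightarrow> (nat \<Rightarrow> 'w \<Rightarrow> real) \<Rightarrow> ennreal" where
  "moment_bound P S X =
     max (SUP \<theta>\<in>{\<theta>\<in>carrier_vec (card S). vnorm \<theta> = 1}.
            ennreal ((\<integral>\<omega>. (rv_sub S X \<omega> \<bullet> \<theta>) ^ 4 \<partial>P) powr (1 / 4)))
         (psi_norm P 2 (\<lambda>\<omega>. vnorm (rv_sub S X \<omega>)))"

definition linear_model ::
  "'w measure \<Rightarrow> nat set \<Rightarrow> (nat \<Rightarrow> 'w \<Rightarrow> real) \<Rightarrow> nat \<Rightarrow> (nat \<Rightarrow> 'w \<Rightarrow> real) \<Rightarrow>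
   real mat \<Rightarrow> real mat \<Rightarrow> (nat \<Rightarrow> 'w \<Rightarrow> real) \<Rightarrow> bool" where
  "linear_model P S X k F \<beta> \<Gamma> E \<longleftrightarrow>
     \<beta> \<in> carrier_mat k (card S) \<and>
     (AE \<omega> in P. vec k (\<lambda>j. F j \<omega>) = \<beta> *\<^sub>v rv_sub S X \<omega> + vec k (\<lambda>j. E j \<omega>)) \<and>
     centred_gaussian P k E \<Gamma> \<and>
     prob_space.indep_var P (coord_space S) (coords S X) (coord_space {..<k}) (coords {..<k} E)"

subsection \<open>Samples and estimators\<close>

text \<open>
  Sample \<open>l\<close> consists of the variables \<open>Xs l i\<close> with \<open>i\<close> in \<open>{1..n}\<close> and the response
  coordinates \<open>Fs l j\<close> with \<open>j < k\<close>. The \<open>t\<close> samples are numbered from 0.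
\<close>

definition iid_samples ::
  "'w measure \<Rightarrow> nat \<Rightarrow> (nat \<Rightarrow> 'w \<Rightarrow> real) \<Rightarrow> nat \<Rightarrow> (nat \<Rightarrow> 'w \<Rightarrow> real) \<Rightarrow>
   nat \<Rightarrow> (nat \<Rightarrow> nat \<Rightarrow> 'w \<Rightarrow> real) \<Rightarrow> (nat \<Rightarrow> nat \<Rightarrow> 'w \<Rightarrow> real) \<Rightarrow> bool" where
  "iid_samples P n X k F t Xs Fs \<longleftrightarrow>
     prob_space.indep_vars P (\<lambda>_. coord_space {1..n} \<Otimes>\<^sub>M coord_space {..<k})
       (\<lambda>l \<omega>. (coords {1..n} (Xs l) \<omega>, coords {..<k} (Fs l) \<omega>)) {..<t} \<and>
     (\<forall>l<t.
        distr P (coord_space {1..n} \<Otimes>\<^sub>M coord_space {..<k})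
          (\<lambda>\<omega>. (coords {1..n} (Xs l) \<omega>, coords {..<k} (Fs l) \<omega>)) =
        distr P (coord_space {1..n} \<Otimes>\<^sub>M coord_space {..<k})
          (\<lambda>\<omega>. (coords {1..n} X \<omega>, coords {..<k} F \<omega>)))"

text \<open>The estimators are functions of the observed values \<open>x l i\<close> and \<open>y l j\<close>.\<close>

definition design_mat :: "nat set \<Rightarrow> nat \<Rightarrow> (nat \<Rightarrow> nat \<Rightarrow> real) \<Rightarrow> real mat" where
  "design_mat S t x = mat t (card S) (\<lambda>(l, a). sub_vec S (x l) $ a)"

definition beta_hat ::
  "nat set \<Rightarrow> nat \<Rightarrow> nat \<Rightarrow> (nat \<Rightarrow> nat \<Rightarrow> real) \<Rightarrow> (nat \<Rightarrow> nat \<Rightarrow> real) \<Rightarrow> real mat" where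
  "beta_hat S k t x y = mat k t (\<lambda>(j, l). y l j) * (left_pinv (design_mat S t x))\<^sup>T"

definition x_hat :: "nat set \<Rightarrow> nat \<Rightarrow> (nat \<Rightarrow> nat \<Rightarrow> real) \<Rightarrow> real vec" where
  "x_hat S t x = vec (card S) (\<lambda>a. 1 / real t * (\<Sum>l<t. sub_vec S (x l) $ a))"

definition Sigma_hat :: "nat set \<Rightarrow> nat \<Rightarrow> (nat \<Rightarrow> nat \<Rightarrow> real) \<Rightarrow> real mat" where
  "Sigma_hat S t x =
     mat (card S) (card S) (\<lambda>(a, b). 1 / (real t - 1) *
       (\<Sum>l<t. (sub_vec S (x l) - x_hat S t x) $ a * (sub_vec S (x l) - x_hat S t x) $ b))"

definition trace_form :: "real mat \<Rightarrow> real mat \<Rightarrow> real mat \<Rightarrow> real" where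
  "trace_form Sig B Q = mtrace (Sig * B\<^sup>T * Q\<^sup>T * Q * B)"

end

theory Submission
  imports Defs "HOL-Real_Asymp.Real_Asymp"
begin

text \<open>
  Write \<open>\<rho> = sqrt (ln t / t)\<close>. Products of two sub-Gaussian variables are subexponential, so by Chernoff's
  bound each of the averages of \<open>X\<^sub>a X\<^sub>b\<close>, \<open>X\<^sub>a\<close> and \<open>(Q \<epsilon>)\<^sub>i X\<^sub>a\<close> deviates from its mean by more than a
  multiple of \<open>\<rho>\<close> with probability at most \<open>2 / t\<^sup>3\<close>; their number depends on \<open>q\<close>, but is absorbed by one
  factor \<open>t\<close> when \<open>t\<close> is large.

  On the remaining event the error \<open>d\<close> of a row of \<open>Q \<beta>\<close> solves \<open>d G = N\<close>, where \<open>G\<close> is the empirical second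
  moment matrix and \<open>N\<close> the averaged product of noise and regressors. Since \<open>G\<close> is close to the second moment
  matrix, it is uniformly positive definite (in particular invertible), and pairing the equation with
  \<open>d\<close> bounds \<open>d\<close> by \<open>N\<close> without any estimate of \<open>G\<inverse>\<close>. Summing squares over the rows turns the trace of the
  noise covariance into \<open>M\<close> times the squared norm of \<open>Q \<beta>\<close>, which is at most a multiple of the true trace.
  The constant may depend on the law of the regressors, so for the condition number only \<open>\<kappa> \<ge> 1\<close> matters.
\<close>

section \<open>Concentration of subexponential averages\<close>

text \<open>\<open>C\<close> is bound before the probability space, \<open>k\<^sub>0\<close>,
  \<open>q\<close>, \<open>Q\<close> and the noise, so it may use only what \<mu> and
  \<open>M\<close> determine. All estimates are therefore expressed through a sub-Gaussian scale
  \<open>c\<close> and a coercivity constant \<open>lam\<close> of the covariance form, read off one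
  realisation of \<mu> and carried to every other one by equality of laws. The dimension of the
  response drops out because the trace sees the estimate only through the \<open>q\<close> rows of
  its product with \<open>Q\<close>, and the noise only through the scalar Gaussians
  \<open>(Q \<epsilon>)_i\<close>. The number \<open>q\<close> drops out because rows enter through
  sums of squares; a relative bound row by row would fail, as a row may carry noise but no signal.
  Cross terms between a row \<open>v\<close> and its error \<open>d\<close> are split with weight
  \<rho> into \<rho> |v|^2 and |d|^2 / \<rho>. Since |d|^2, summed over the rows, is of order
  \<rho>^2 times the signal, both parts are of order \<rho>. A nonmeasurable set has
  \<open>measure\<close> zero, so a lower bound on a probability also needs measurability of the
  error event; this is why an explicit formula for the inverse appears.\<close>

lemma exp_le_quadratic_exp_abs:
  fixes l y :: real
  assumes "\<bar>l\<bar> \<le> 1 / 2"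
  shows "exp (l * y) \<le> 1 + l * y + 4 * l\<^sup>2 * exp \<bar>y\<bar>"
proof -
  obtain z where z: "\<bar>z\<bar> \<le> \<bar>l * y\<bar>"
    and e: "exp (l * y) = (\<Sum>m<2. (l * y) ^ m / fact m) + exp z / fact 2 * (l * y)\<^sup>2"
    using Maclaurin_exp_le[of "l * y" 2] by auto
  \<comment> \<open>The restriction on \<open>l\<close> leaves half of the exponent
    \<open>\<bar>y\<bar>\<close> for the remainder factor \<open>exp z\<close>; the other half
    absorbs \<open>y\<^sup>2\<close>, at the cost of the factor 8. Halved by the Taylor coefficient,
    this is the 4 of the claim.\<close>
  have "\<bar>l * y\<bar> \<le> \<bar>y\<bar> / 2"
    using mult_right_mono[OF assms, of "\<bar>y\<bar>"] by (simp add: abs_mult)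
  hence ez: "exp z \<le> exp (\<bar>y\<bar> / 2)" using z by simp
  have "1 + \<bar>y\<bar> / 2 + (\<bar>y\<bar> / 2)\<^sup>2 / 2 \<le> exp (\<bar>y\<bar> / 2)"
    by (rule exp_lower_Taylor_quadratic) simp
  hence y2: "y\<^sup>2 \<le> 8 * exp (\<bar>y\<bar> / 2)" by (simp add: power_divide)
  have "exp z * y\<^sup>2 \<le> exp (\<bar>y\<bar> / 2) * (8 * exp (\<bar>y\<bar> / 2))"
    by (intro mult_mono ez y2) auto
  also have "\<dots> = 8 * exp \<bar>y\<bar>" by (simp flip: exp_add)
  finally have "l\<^sup>2 * (exp z * y\<^sup>2) \<le> l\<^sup>2 * (8 * exp \<bar>y\<bar>)"
    by (intro mult_left_mono) auto
  thus ?thesis unfolding e by (simp add: numeral_2_eq_2 power_mult_distrib algebra_simps)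
qed

context prob_space
begin

text \<open>Scale conditions are stated with the nonnegative integral, which makes finiteness part
  of the condition; this is the passage to the Bochner integral.\<close>

lemma subexp_integrable_exp:
  fixes W :: "'a \<Rightarrow> real"
  assumes [measurable]: "W \<in> borel_measurable M"
    and W: "(\<integral>\<^sup>+x. ennreal (exp (\<bar>W x\<bar> / c)) \<partial>M) \<le> 2"
  shows "integrable M (\<lambda>x. exp (\<bar>W x\<bar> / c))" "expectation (\<lambda>x. exp (\<bar>W x\<bar> / c)) \<le> 2"
proof -
  show "integrable M (\<lambda>x. exp (\<bar>W x\<bar> / c))"
    using W by (intro integrableI_bounded) (auto simp: le_less_trans)
  then show "expectation (\<lambda>x. exp (\<bar>W x\<bar> / c)) \<le> 2"
    using W by (simp add: nn_integral_eq_integral ennreal_le_iff flip: ennreal_numeral)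
qed

lemma subexp_integrable:
  fixes W :: "'a \<Rightarrow> real"
  assumes [measurable]: "W \<in> borel_measurable M" and "c > 0"
    and W: "(\<integral>\<^sup>+x. ennreal (exp (\<bar>W x\<bar> / c)) \<partial>M) \<le> 2"
  shows "integrable M W" "\<bar>expectation W\<bar> \<le> 2 * c"
proof -
  note i = subexp_integrable_exp[OF assms(1) W]
  have le: "\<bar>W x\<bar> \<le> c * exp (\<bar>W x\<bar> / c)" for x
  proof -
    have "\<bar>W x\<bar> / c \<le> exp (\<bar>W x\<bar> / c)"
      using exp_ge_add_one_self[of "\<bar>W x\<bar> / c"] by linarith
    thus ?thesis using \<open>c > 0\<close> by (simp add: field_simps)
  qed
  show int: "integrable M W"
    by (rule Bochner_Integration.integrable_bound[OF integrable_mult_right[OF i(1), of c]])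
       (use le \<open>c > 0\<close> in auto)
  have "\<bar>expectation W\<bar> \<le> expectation (\<lambda>x. \<bar>W x\<bar>)" by (rule integral_abs_bound)
  also have "\<dots> \<le> expectation (\<lambda>x. c * exp (\<bar>W x\<bar> / c))"
    using int i(1) le by (intro integral_mono) auto
  also have "\<dots> \<le> 2 * c" using i(2) \<open>c > 0\<close> by simp
  finally show "\<bar>expectation W\<bar> \<le> 2 * c" .
qed

text \<open>Integrating the quadratic bound at \<open>W / c\<close> gives \<open>8 = 4 * 2\<close>,
  the 2 being the bound on the exponential moment; then \<open>1 + x \<le> exp x\<close>. The mean
  stays in the exponent, because centring \<open>W\<close> first would change its scale.\<close>

lemma subexp_mgf:
  fixes W :: "'a \<Rightarrow> real"
  assumes [measurable]: "W \<in> borel_measurable M" and c: "c > 0"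
    and W: "(\<integral>\<^sup>+x. ennreal (exp (\<bar>W x\<bar> / c)) \<partial>M) \<le> 2" and l: "\<bar>l\<bar> \<le> 1 / 2"
  shows "(\<integral>\<^sup>+x. ennreal (exp (l * (W x / c))) \<partial>M) \<le> ennreal (exp (l * expectation W / c + 8 * l\<^sup>2))"
proof -
  note i = subexp_integrable_exp[OF assms(1) W] subexp_integrable[OF assms(1) c W]
  have le: "exp (l * (W x / c)) \<le> 1 + l * (W x / c) + 4 * l\<^sup>2 * exp (\<bar>W x\<bar> / c)" for x
    using exp_le_quadratic_exp_abs[OF l, of "W x / c"] c by simp
  have nn: "0 \<le> 1 + l * (W x / c) + 4 * l\<^sup>2 * exp (\<bar>W x\<bar> / c)" for x
    using le[of x] exp_ge_zero[of "l * (W x / c)"] by linarith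
  have "(\<integral>\<^sup>+x. ennreal (exp (l * (W x / c))) \<partial>M)
      \<le> (\<integral>\<^sup>+x. ennreal (1 + l * (W x / c) + 4 * l\<^sup>2 * exp (\<bar>W x\<bar> / c)) \<partial>M)"
    by (intro nn_integral_mono ennreal_leI le)
  also have "\<dots> = ennreal (expectation (\<lambda>x. 1 + l * (W x / c) + 4 * l\<^sup>2 * exp (\<bar>W x\<bar> / c)))"
    using nn i by (intro nn_integral_eq_integral) auto
  also have "expectation (\<lambda>x. 1 + l * (W x / c) + 4 * l\<^sup>2 * exp (\<bar>W x\<bar> / c))
     = 1 + l * (expectation W / c) + 4 * l\<^sup>2 * expectation (\<lambda>x. exp (\<bar>W x\<bar> / c))"
    using i by (simp add: prob_space)
  also have "ennreal \<dots> \<le> ennreal (exp (l * expectation W / c + 8 * l\<^sup>2))"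
  proof (intro ennreal_leI)
    have "4 * l\<^sup>2 * expectation (\<lambda>x. exp (\<bar>W x\<bar> / c)) \<le> 4 * l\<^sup>2 * 2"
      using i(2) by (intro mult_left_mono) auto
    thus "1 + l * (expectation W / c) + 4 * l\<^sup>2 * expectation (\<lambda>x. exp (\<bar>W x\<bar> / c))
        \<le> exp (l * expectation W / c + 8 * l\<^sup>2)"
      using exp_ge_add_one_self[of "l * expectation W / c + 8 * l\<^sup>2"]
      unfolding times_divide_eq_right by linarith
  qed
  finally show ?thesis .
qed

text \<open>Chernoff's bound at the exponent \<open>sqrt (ln t / t) / c\<close>; the factor 11 makes the total
  exponent \<open>(8 - 11) * ln t\<close>.\<close>

lemma subexp_upper_tail:
  fixes W :: "nat \<Rightarrow> 'a \<Rightarrow> real" and t :: nat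
  assumes ind: "indep_vars (\<lambda>_. borel) W {..<t}" and c: "c > 0"
    and W: "\<And>l. l < t \<Longrightarrow> (\<integral>\<^sup>+x. ennreal (exp (\<bar>W l x\<bar> / c)) \<partial>M) \<le> 2"
    and m: "\<And>l. l < t \<Longrightarrow> expectation (W l) = m"
    and t: "t > 1" and \<rho>: "sqrt (ln t / t) \<le> 1 / 2"
  shows "prob {x\<in>space M. (\<Sum>l<t. W l x) / t - m \<ge> 11 * c * sqrt (ln t / t)} \<le> 1 / real t ^ 3"
proof -
  define r where "r = sqrt (ln t / t)"
  have meas: "W l \<in> borel_measurable M" if "l < t" for l
    using ind that by (auto simp: indep_vars_def)
  have r0: "r > 0" and r2: "t * r\<^sup>2 = ln t" and r1: "\<bar>r\<bar> \<le> 1 / 2"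
    using t \<rho> by (auto simp: r_def)
  have meas_sum: "(\<lambda>x. \<Sum>l<t. W l x / c) \<in> borel_measurable M" using meas by auto
  let ?a = "t * (m / c) + 11 * t * r"
  have set_eq: "(\<Sum>l<t. W l x) / t - m \<ge> 11 * c * r \<longleftrightarrow> (\<Sum>l<t. W l x / c) \<ge> ?a" for x
  proof -
    have "c * ?a = t * m + 11 * t * r * c" using c by (simp add: field_simps)
    moreover have "(\<Sum>l<t. W l x) / t - m \<ge> 11 * c * r \<longleftrightarrow> (\<Sum>l<t. W l x) \<ge> t * m + 11 * t * r * c"
      using t by (simp add: field_simps)
    ultimately have "(\<Sum>l<t. W l x) / t - m \<ge> 11 * c * r \<longleftrightarrow> (\<Sum>l<t. W l x) \<ge> c * ?a"
      by simp
    thus ?thesis using c by (simp add: pos_le_divide_eq mult.commute flip: sum_divide_distrib)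
  qed
  have "emeasure M {x\<in>space M. (\<Sum>l<t. W l x) / t - m \<ge> 11 * c * r}
      \<le> ennreal (exp (- r * ?a)) * (\<integral>\<^sup>+x. ennreal (exp (r * (\<Sum>l<t. W l x / c))) * indicator (space M) x \<partial>M)"
    unfolding set_eq using r0 meas_sum by (intro Chernoff_ineq_nn_integral_ge) auto
  also have "(\<integral>\<^sup>+x. ennreal (exp (r * (\<Sum>l<t. W l x / c))) * indicator (space M) x \<partial>M)
      = (\<integral>\<^sup>+x. (\<Prod>l<t. ennreal (exp (r * (W l x / c)))) \<partial>M)"
    by (intro nn_integral_cong) (simp add: sum_distrib_left exp_sum prod_ennreal)
  also have "\<dots> = (\<Prod>l<t. \<integral>\<^sup>+x. ennreal (exp (r * (W l x / c))) \<partial>M)"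
    by (intro indep_vars_nn_integral indep_vars_compose2[OF ind]) auto
  also have "\<dots> \<le> (\<Prod>l<t. ennreal (exp (r * m / c + 8 * r\<^sup>2)))"
    using subexp_mgf[OF meas c W r1] m by (intro prod_mono_ennreal) auto
  also have "\<dots> = ennreal (exp (t * (r * m / c + 8 * r\<^sup>2)))"
    by (simp add: exp_of_nat_mult ennreal_power)
  \<comment> \<open>The mean contributes \<open>t * r * m / c\<close> with opposite signs and
    cancels; only multiples of \<open>t * r\<^sup>2 = ln t\<close> remain.\<close>
  also have "ennreal (exp (- r * ?a)) * ennreal (exp (t * (r * m / c + 8 * r\<^sup>2)))
      = ennreal (exp (- 3 * (t * r\<^sup>2)))"
    by (simp add: algebra_simps power2_eq_square flip: ennreal_mult exp_add)
  also have "exp (- 3 * (t * r\<^sup>2)) = 1 / real t ^ 3"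
    using t exp_of_nat_mult[of 3 "ln (real t)"] unfolding r2 by (simp add: exp_minus field_simps)
  finally have "emeasure M {x\<in>space M. (\<Sum>l<t. W l x) / t - m \<ge> 11 * c * r} \<le> ennreal (1 / real t ^ 3)"
    by (simp add: mult_left_mono)
  thus ?thesis unfolding r_def[symmetric] emeasure_eq_measure by (subst (asm) ennreal_le_iff) auto
qed

lemma subexp_concentration:
  fixes W :: "nat \<Rightarrow> 'a \<Rightarrow> real" and t :: nat
  assumes ind: "indep_vars (\<lambda>_. borel) W {..<t}" and c: "c > 0"
    and W: "\<And>l. l < t \<Longrightarrow> (\<integral>\<^sup>+x. ennreal (exp (\<bar>W l x\<bar> / c)) \<partial>M) \<le> 2"
    and m: "\<And>l. l < t \<Longrightarrow> expectation (W l) = m"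
    and t: "t > 1" and \<rho>: "sqrt (ln t / t) \<le> 1 / 2"
  shows "prob {x\<in>space M. \<bar>(\<Sum>l<t. W l x) / t - m\<bar> \<ge> 11 * c * sqrt (ln t / t)} \<le> 2 / real t ^ 3"
proof -
  let ?r = "11 * c * sqrt (ln t / t)"
  have meas [measurable]: "W l \<in> borel_measurable M" if "l < t" for l
    using ind that by (auto simp: indep_vars_def)
  have [measurable]: "(\<lambda>x. \<Sum>l<t. W l x) \<in> borel_measurable M" by auto
  have "prob {x\<in>space M. (\<Sum>l<t. - W l x) / t - (- m) \<ge> ?r} \<le> 1 / real t ^ 3"
    using W m by (intro subexp_upper_tail c t \<rho> indep_vars_compose2[OF ind]) auto
  moreover have "prob {x\<in>space M. (\<Sum>l<t. W l x) / t - m \<ge> ?r} \<le> 1 / real t ^ 3"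
    using assms by (rule subexp_upper_tail)
  moreover have "prob {x\<in>space M. \<bar>(\<Sum>l<t. W l x) / t - m\<bar> \<ge> ?r}
      \<le> prob ({x\<in>space M. (\<Sum>l<t. W l x) / t - m \<ge> ?r} \<union> {x\<in>space M. (\<Sum>l<t. - W l x) / t - (- m) \<ge> ?r})"
    by (intro finite_measure_mono) (auto simp: sum_negf)
  moreover have "\<dots> \<le> prob {x\<in>space M. (\<Sum>l<t. W l x) / t - m \<ge> ?r} + prob {x\<in>space M. (\<Sum>l<t. - W l x) / t - (- m) \<ge> ?r}"
    by (intro measure_Un_le) (auto simp: sum_negf)
  ultimately show ?thesis by simp
qed

text \<open>Scale and mean depend only on the distribution of an observation, so they need to be
  known for the reference \<open>Z0\<close> alone. An observation will be a pair of regressors and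
  response, and \<open>h\<close> a statistic of it.\<close>

lemma iid_subexp_concentration:
  fixes h :: "'b \<Rightarrow> real" and t :: nat
  assumes ind: "indep_vars (\<lambda>_. N) Z {..<t}"
    and id: "\<And>l. l < t \<Longrightarrow> distr M N (Z l) = distr M N Z0"
    and [measurable]: "Z0 \<in> measurable M N" "h \<in> borel_measurable N" and c: "c > 0"
    and h: "(\<integral>\<^sup>+x. ennreal (exp (\<bar>h (Z0 x)\<bar> / c)) \<partial>M) \<le> 2"
    and t: "t > 1" and \<rho>: "sqrt (ln t / t) \<le> 1 / 2"
  shows "prob {x\<in>space M. \<bar>(\<Sum>l<t. h (Z l x)) / t - expectation (\<lambda>x. h (Z0 x))\<bar> \<ge> 11 * c * sqrt (ln t / t)}
    \<le> 2 / real t ^ 3"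
proof (rule subexp_concentration[OF _ c _ _ t \<rho>])
  show "indep_vars (\<lambda>_. borel) (\<lambda>l x. h (Z l x)) {..<t}"
    by (rule indep_vars_compose2[OF ind]) auto
next
  fix l assume l: "l < t"
  have [measurable]: "Z l \<in> measurable M N" using ind l by (auto simp: indep_vars_def)
  have "(\<integral>\<^sup>+x. ennreal (exp (\<bar>h (Z l x)\<bar> / c)) \<partial>M) = (\<integral>\<^sup>+z. ennreal (exp (\<bar>h z\<bar> / c)) \<partial>distr M N (Z l))"
    by (simp add: nn_integral_distr)
  also have "\<dots> = (\<integral>\<^sup>+x. ennreal (exp (\<bar>h (Z0 x)\<bar> / c)) \<partial>M)"
    unfolding id[OF l] by (simp add: nn_integral_distr)
  finally show "(\<integral>\<^sup>+x. ennreal (exp (\<bar>h (Z l x)\<bar> / c)) \<partial>M) \<le> 2" using h by simp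
  have "expectation (\<lambda>x. h (Z l x)) = (\<integral>z. h z \<partial>distr M N (Z l))" by (simp add: integral_distr)
  also have "\<dots> = expectation (\<lambda>x. h (Z0 x))" unfolding id[OF l] by (simp add: integral_distr)
  finally show "expectation (\<lambda>x. h (Z l x)) = expectation (\<lambda>x. h (Z0 x))" .
qed

text \<open>The inequality between arithmetic and geometric mean is used twice, in the exponent and
  for the resulting product of exponentials. The argument is pointwise, so it covers dependent
  factors and squares as well.\<close>

lemma subgaussian_mult_subexp:
  fixes U V :: "'a \<Rightarrow> real"
  assumes [measurable]: "U \<in> borel_measurable M" "V \<in> borel_measurable M"
    and a: "a > 0" and b: "b > 0"
    and U: "(\<integral>\<^sup>+x. ennreal (exp ((U x)\<^sup>2 / a\<^sup>2)) \<partial>M) \<le> 2"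
    and V: "(\<integral>\<^sup>+x. ennreal (exp ((V x)\<^sup>2 / b\<^sup>2)) \<partial>M) \<le> 2"
  shows "(\<integral>\<^sup>+x. ennreal (exp (\<bar>U x * V x\<bar> / (a * b))) \<partial>M) \<le> 2"
proof -
  have le: "exp (\<bar>u * v\<bar> / (a * b)) \<le> (exp (u\<^sup>2 / a\<^sup>2) + exp (v\<^sup>2 / b\<^sup>2)) / 2" for u v :: real
  proof -
    let ?x = "\<bar>u\<bar> / a" and ?y = "\<bar>v\<bar> / b"
    have "exp (\<bar>u * v\<bar> / (a * b)) = exp (?x * ?y)" by (simp add: abs_mult)
    also have "\<dots> \<le> exp (?x\<^sup>2 / 2 + ?y\<^sup>2 / 2)"
      using sum_squares_bound[of ?x ?y] by simp
    also have "\<dots> = exp (?x\<^sup>2 / 2) * exp (?y\<^sup>2 / 2)" by (simp add: exp_add)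
    also have "\<dots> \<le> ((exp (?x\<^sup>2 / 2))\<^sup>2 + (exp (?y\<^sup>2 / 2))\<^sup>2) / 2"
      using sum_squares_bound[of "exp (?x\<^sup>2 / 2)" "exp (?y\<^sup>2 / 2)"] by simp
    also have "\<dots> = (exp (u\<^sup>2 / a\<^sup>2) + exp (v\<^sup>2 / b\<^sup>2)) / 2"
      by (simp add: power_divide flip: exp_double)
    finally show ?thesis .
  qed
  have "(\<integral>\<^sup>+x. ennreal (exp (\<bar>U x * V x\<bar> / (a * b))) \<partial>M)
      \<le> (\<integral>\<^sup>+x. ennreal ((exp ((U x)\<^sup>2 / a\<^sup>2) + exp ((V x)\<^sup>2 / b\<^sup>2)) / 2) \<partial>M)"
    by (intro nn_integral_mono ennreal_leI le)
  also have "\<dots> = (\<integral>\<^sup>+x. (ennreal (exp ((U x)\<^sup>2 / a\<^sup>2)) + ennreal (exp ((V x)\<^sup>2 / b\<^sup>2))) / 2 \<partial>M)"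
    by (intro nn_integral_cong) (simp flip: ennreal_plus ennreal_numeral add: divide_ennreal)
  also have "\<dots> = ((\<integral>\<^sup>+x. ennreal (exp ((U x)\<^sup>2 / a\<^sup>2)) \<partial>M) + (\<integral>\<^sup>+x. ennreal (exp ((V x)\<^sup>2 / b\<^sup>2)) \<partial>M)) / 2"
    by (simp add: nn_integral_divide nn_integral_add)
  also have "\<dots> \<le> (2 + 2) / 2" by (intro divide_right_mono_ennreal add_mono U V)
  also have "\<dots> = 2" by (simp add: divide_ennreal flip: ennreal_numeral ennreal_plus)
  finally show ?thesis .
qed

text \<open>The second factor is the constant 1, which has sub-Gaussian scale 2 because
  \<open>exp (1 / 4) \<le> 2\<close>; hence the product scale \<open>2 * d\<close>.\<close>

lemma subexp_of_subgaussian: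
  fixes U :: "'a \<Rightarrow> real"
  assumes [measurable]: "U \<in> borel_measurable M" and "d > 0"
    and "(\<integral>\<^sup>+\<omega>. ennreal (exp ((U \<omega>)\<^sup>2 / d\<^sup>2)) \<partial>M) \<le> 2"
  shows "(\<integral>\<^sup>+\<omega>. ennreal (exp (\<bar>U \<omega>\<bar> / (2 * d))) \<partial>M) \<le> 2"
proof -
  have "exp (1 / 4) \<le> (2::real)" using exp_bound[of "1 / 4"] by (simp add: power2_eq_square)
  hence "(\<integral>\<^sup>+\<omega>. ennreal (exp (1\<^sup>2 / 2\<^sup>2)) \<partial>M) \<le> 2"
    by (simp add: emeasure_space_1 flip: ennreal_numeral)
  from subgaussian_mult_subexp[OF assms(1) _ assms(2) _ assms(3) this]
  show ?thesis by (simp add: mult.commute)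
qed

end

text \<open>For \<open>a\<^sup>2 \<ge> 4 * v\<close> the factor
  \<open>exp (x\<^sup>2 / a\<^sup>2)\<close> consumes at most half of the Gaussian exponent. What
  remains is at most \<open>sqrt 2\<close> times the density of variance \<open>2 * v\<close>, whose
  integral is 1. The degenerate law gives the value 1.\<close>

lemma nn_integral_exp_square_normal_law:
  assumes "v \<ge> 0" "a \<ge> 2 * sqrt v" "a > 0"
  shows "(\<integral>\<^sup>+x. ennreal (exp (x\<^sup>2 / a\<^sup>2)) \<partial>normal_law 0 v) \<le> 2"
proof (cases "v = 0")
  case True
  thus ?thesis by (simp add: normal_law_def nn_integral_return)
next
  case False
  hence v: "v > 0" using assms by simp
  have a2: "a\<^sup>2 \<ge> 4 * v"
    using power_mono[OF assms(2), of 2] v by (simp add: power_mult_distrib)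
  have pt: "normal_density 0 (sqrt v) x * exp (x\<^sup>2 / a\<^sup>2) \<le> sqrt 2 * normal_density 0 (sqrt (2 * v)) x" for x
  proof -
    have le: "x\<^sup>2 / a\<^sup>2 \<le> x\<^sup>2 / (4 * v)" using a2 v \<open>a > 0\<close> by (intro divide_left_mono) auto
    have "exp (- x\<^sup>2 / (2 * v)) * exp (x\<^sup>2 / a\<^sup>2) \<le> exp (- x\<^sup>2 / (2 * (2 * v)))"
    proof -
      have "- x\<^sup>2 / (2 * v) + x\<^sup>2 / (4 * v) = - x\<^sup>2 / (2 * (2 * v))"
        using v by (simp add: field_simps)
      with le show ?thesis by (simp flip: exp_add)
    qed
    hence "1 / sqrt (2 * pi * v) * (exp (- x\<^sup>2 / (2 * v)) * exp (x\<^sup>2 / a\<^sup>2))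
        \<le> 1 / sqrt (2 * pi * v) * exp (- x\<^sup>2 / (2 * (2 * v)))"
      using v by (intro mult_left_mono) auto
    also have "1 / sqrt (2 * pi * v) * exp (- x\<^sup>2 / (2 * (2 * v)))
        = (sqrt 2 * (1 / sqrt (2 * pi * (2 * v)))) * exp (- x\<^sup>2 / (2 * (2 * v)))"
      using v by (simp add: real_sqrt_mult field_simps)
    finally show ?thesis using v unfolding normal_density_def by (simp add: mult.assoc)
  qed
  have "(\<integral>\<^sup>+x. ennreal (exp (x\<^sup>2 / a\<^sup>2)) \<partial>normal_law 0 v)
      = (\<integral>\<^sup>+x. ennreal (normal_density 0 (sqrt v) x * exp (x\<^sup>2 / a\<^sup>2)) \<partial>lborel)"
    using False by (simp add: normal_law_def nn_integral_density ennreal_mult)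
  also have "\<dots> \<le> (\<integral>\<^sup>+x. ennreal (sqrt 2 * normal_density 0 (sqrt (2 * v)) x) \<partial>lborel)"
    by (intro nn_integral_mono ennreal_leI pt)
  also have "\<dots> = ennreal (\<integral>x. sqrt 2 * normal_density 0 (sqrt (2 * v)) x \<partial>lborel)"
    using v by (intro nn_integral_eq_integral) auto
  also have "\<dots> = ennreal (sqrt 2)" using v by simp
  also have "\<dots> \<le> 2" using sqrt2_less_2 by (simp flip: ennreal_numeral)
  finally show ?thesis .
qed

lemma integral_normal_law:
  assumes "v \<ge> 0"
  shows "(\<integral>x. x \<partial>normal_law m v) = m"
  using assms integral_normal_moment_nz_1[of "sqrt v" m]
  by (auto simp: normal_law_def integral_return integral_density)

section \<open>Quadratic forms and perturbation\<close>

text \<open>Vectors and forms are plain functions of the indices below \<open>s\<close>, so that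
  empirical averages and expectations can be inserted as coefficients without carrier
  conditions.\<close>

definition sq_norm_fun :: "nat \<Rightarrow> (nat \<Rightarrow> real) \<Rightarrow> real" where
  "sq_norm_fun s v = (\<Sum>a<s. (v a)\<^sup>2)"

definition bilin :: "nat \<Rightarrow> (nat \<Rightarrow> nat \<Rightarrow> real) \<Rightarrow> (nat \<Rightarrow> real) \<Rightarrow> (nat \<Rightarrow> real) \<Rightarrow> real" where
  "bilin s A u v = (\<Sum>a<s. \<Sum>b<s. A a b * u a * v b)"

lemma sq_norm_fun_nonneg [simp]: "0 \<le> sq_norm_fun s v"
  by (simp add: sq_norm_fun_def sum_nonneg)

lemma two_mult_le_weighted:
  fixes x y \<eta> :: real
  assumes "\<eta> > 0"
  shows "2 * (x * y) \<le> \<eta> * x\<^sup>2 + y\<^sup>2 / \<eta>"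
proof -
  have "0 \<le> (\<eta> * x - y)\<^sup>2 / \<eta>" using assms by simp
  also have "\<dots> = \<eta> * x\<^sup>2 + y\<^sup>2 / \<eta> - 2 * (x * y)"
    using assms by (simp add: power2_eq_square field_simps)
  finally show ?thesis by simp
qed

text \<open>Entrywise Young inequality. The free weight \<eta> serves arguments of different size,
  and the bound is linear in the squared norms, so it can be summed over the rows of a
  matrix.\<close>

lemma abs_bilin_le:
  assumes A: "\<And>a b. a < s \<Longrightarrow> b < s \<Longrightarrow> \<bar>A a b\<bar> \<le> e" and \<eta>: "\<eta> > 0"
  shows "\<bar>bilin s A u v\<bar> \<le> e * s * (\<eta> * sq_norm_fun s u + sq_norm_fun s v / \<eta>) / 2"
proof -
  have "\<bar>bilin s A u v\<bar> \<le> (\<Sum>a<s. \<Sum>b<s. \<bar>A a b * u a * v b\<bar>)"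
    unfolding bilin_def by (rule order.trans[OF sum_abs]) (intro sum_mono sum_abs)
  also have "\<dots> \<le> (\<Sum>a<s. \<Sum>b<s. e * ((\<eta> * (u a)\<^sup>2 + (v b)\<^sup>2 / \<eta>) / 2))"
  proof (intro sum_mono)
    fix a b assume ab: "a \<in> {..<s}" "b \<in> {..<s}"
    have "\<bar>u a\<bar> * \<bar>v b\<bar> \<le> (\<eta> * (u a)\<^sup>2 + (v b)\<^sup>2 / \<eta>) / 2"
      using two_mult_le_weighted[OF \<eta>, of "\<bar>u a\<bar>" "\<bar>v b\<bar>"] by simp
    hence "\<bar>A a b\<bar> * (\<bar>u a\<bar> * \<bar>v b\<bar>) \<le> e * ((\<eta> * (u a)\<^sup>2 + (v b)\<^sup>2 / \<eta>) / 2)"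
      using A[of a b] ab by (intro mult_mono) auto
    thus "\<bar>A a b * u a * v b\<bar> \<le> e * ((\<eta> * (u a)\<^sup>2 + (v b)\<^sup>2 / \<eta>) / 2)"
      by (simp add: abs_mult mult.assoc)
  qed
  also have "\<dots> = e * (s * (\<eta> * sq_norm_fun s u) + s * (sq_norm_fun s v / \<eta>)) / 2"
    by (simp add: sq_norm_fun_def sum.distrib flip: sum_distrib_left sum_divide_distrib)
  also have "\<dots> = e * s * (\<eta> * sq_norm_fun s u + sq_norm_fun s v / \<eta>) / 2"
    by (simp add: algebra_simps)
  finally show ?thesis .
qed

lemma bilin_diff_form: "bilin s (\<lambda>a b. A a b - B a b) u v = bilin s A u v - bilin s B u v"
  by (simp add: bilin_def algebra_simps sum_subtractf)

lemma bilin_self_eq_add_diff: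
  "bilin s A u u = bilin s A v v + bilin s A v (\<lambda>a. u a - v a)
     + bilin s A (\<lambda>a. u a - v a) v + bilin s A (\<lambda>a. u a - v a) (\<lambda>a. u a - v a)"
  by (simp add: bilin_def algebra_simps flip: sum.distrib sum_subtractf)

text \<open>An entrywise error \<open>e\<close> changes the form by at most \<open>e * s\<close>
  times the squared norm, which here costs at most half of the coercivity.\<close>

lemma bilin_ge_of_close:
  assumes "\<And>v. bilin s L v v \<ge> lam * sq_norm_fun s v"
    and "\<And>a b. a < s \<Longrightarrow> b < s \<Longrightarrow> \<bar>G a b - L a b\<bar> \<le> e" and "e * s \<le> lam / 2"
  shows "bilin s G v v \<ge> lam / 2 * sq_norm_fun s v"
proof -
  have "\<bar>bilin s (\<lambda>a b. G a b - L a b) v v\<bar> \<le> e * s * (1 * sq_norm_fun s v + sq_norm_fun s v / 1) / 2"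
    by (rule abs_bilin_le) (use assms in auto)
  also have "\<dots> \<le> lam / 2 * sq_norm_fun s v"
    using mult_right_mono[OF assms(3), of "sq_norm_fun s v"] by simp
  finally have "\<bar>bilin s G v v - bilin s L v v\<bar> \<le> lam / 2 * sq_norm_fun s v"
    by (simp add: bilin_diff_form)
  hence "bilin s L v v - lam / 2 * sq_norm_fun s v \<le> bilin s G v v" by linarith
  moreover have "lam * sq_norm_fun s v = lam / 2 * sq_norm_fun s v + lam / 2 * sq_norm_fun s v" by simp
  ultimately show ?thesis using assms(1)[of v] by linarith
qed

lemma sq_norm_solution_le:
  assumes lam: "lam > 0" and G: "bilin s G d d \<ge> lam / 2 * sq_norm_fun s d"
    and n: "\<And>a. a < s \<Longrightarrow> (\<Sum>b<s. d b * G b a) = n a"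
  shows "sq_norm_fun s d \<le> 4 / lam\<^sup>2 * sq_norm_fun s n"
proof -
  have "bilin s G d d = (\<Sum>a<s. (\<Sum>b<s. d b * G b a) * d a)"
    unfolding bilin_def by (subst sum.swap) (simp add: sum_distrib_left sum_distrib_right mult_ac)
  also have "\<dots> = (\<Sum>a<s. n a * d a)" by (intro sum.cong) (simp_all add: n)
  \<comment> \<open>The weight \<open>2 / lam\<close> leaves \<open>lam / 4\<close> in front of the
    norm of \<open>d\<close>, half of the available coercivity \<open>lam / 2\<close>, so that this
    term can be absorbed on the left.\<close>
  also have "\<dots> \<le> (\<Sum>a<s. (2 / lam * (n a)\<^sup>2 + (d a)\<^sup>2 / (2 / lam)) / 2)"
  proof (intro sum_mono)
    fix a
    show "n a * d a \<le> (2 / lam * (n a)\<^sup>2 + (d a)\<^sup>2 / (2 / lam)) / 2"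
      using two_mult_le_weighted[of "2 / lam" "n a" "d a"] lam by simp
  qed
  also have "\<dots> = (1 / lam) * sq_norm_fun s n + lam / 4 * sq_norm_fun s d"
    using lam by (simp add: sq_norm_fun_def sum_distrib_left field_simps flip: sum.distrib)
  moreover have "lam / 2 * sq_norm_fun s d = lam / 4 * sq_norm_fun s d + lam / 4 * sq_norm_fun s d" by simp
  ultimately have "lam / 4 * sq_norm_fun s d \<le> (1 / lam) * sq_norm_fun s n" using G by linarith
  hence "4 / lam * (lam / 4 * sq_norm_fun s d) \<le> 4 / lam * ((1 / lam) * sq_norm_fun s n)"
    using lam by (intro mult_left_mono) auto
  thus ?thesis using lam by (simp add: power2_eq_square)
qed

text \<open>With \<open>u = v + d\<close> the difference splits into the change of the form at
  \<open>v\<close>, two cross terms and the form at \<open>d\<close>. The cross terms take the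
  weights \<rho> and 1 / \<rho>, according to the position of \<open>v\<close>. The entries of
  \<open>Sh\<close> are bounded by \<open>L\<^sub>0 + c\<^sub>1\<close> because
  \<open>\<rho> \<le> 1\<close>.\<close>

lemma bilin_self_perturbation:
  fixes c\<^sub>1 L\<^sub>0 \<rho> :: real
  assumes \<rho>: "0 < \<rho>" "\<rho> \<le> 1" and c: "c\<^sub>1 \<ge> 0"
    and Sh: "\<And>a b. a < s \<Longrightarrow> b < s \<Longrightarrow> \<bar>Sh a b - Sg a b\<bar> \<le> c\<^sub>1 * \<rho>"
    and Sg: "\<And>a b. a < s \<Longrightarrow> b < s \<Longrightarrow> \<bar>Sg a b\<bar> \<le> L\<^sub>0"
  shows "\<bar>bilin s Sh u u - bilin s Sg v v\<bar> \<le> s * ((c\<^sub>1 + (L\<^sub>0 + c\<^sub>1)) * \<rho> * sq_norm_fun s v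
     + (L\<^sub>0 + c\<^sub>1) * (1 / \<rho> + 1) * sq_norm_fun s (\<lambda>a. u a - v a))"
proof -
  define d where "d = (\<lambda>a. u a - v a)"
  have L: "\<bar>Sh a b\<bar> \<le> L\<^sub>0 + c\<^sub>1" if "a < s" "b < s" for a b
    using Sh[OF that] Sg[OF that] mult_left_mono[OF \<rho>(2) c] by linarith
  have "bilin s Sh u u - bilin s Sg v v = bilin s (\<lambda>a b. Sh a b - Sg a b) v v
      + bilin s Sh v d + bilin s Sh d v + bilin s Sh d d"
    unfolding bilin_diff_form d_def by (subst bilin_self_eq_add_diff[of s Sh u v]) simp
  moreover have "\<bar>bilin s (\<lambda>a b. Sh a b - Sg a b) v v\<bar>
      \<le> c\<^sub>1 * \<rho> * s * (1 * sq_norm_fun s v + sq_norm_fun s v / 1) / 2"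
    by (rule abs_bilin_le) (use Sh in auto)
  moreover have "\<bar>bilin s Sh v d\<bar> \<le> (L\<^sub>0 + c\<^sub>1) * s * (\<rho> * sq_norm_fun s v + sq_norm_fun s d / \<rho>) / 2"
    by (rule abs_bilin_le) (use L \<rho> in auto)
  moreover have "\<bar>bilin s Sh d v\<bar> \<le> (L\<^sub>0 + c\<^sub>1) * s * (1 / \<rho> * sq_norm_fun s d + sq_norm_fun s v / (1 / \<rho>)) / 2"
    by (rule abs_bilin_le) (use L \<rho> in auto)
  moreover have "\<bar>bilin s Sh d d\<bar> \<le> (L\<^sub>0 + c\<^sub>1) * s * (1 * sq_norm_fun s d + sq_norm_fun s d / 1) / 2"
    by (rule abs_bilin_le) (use L in auto)
  moreover have "c\<^sub>1 * \<rho> * s * (1 * sq_norm_fun s v + sq_norm_fun s v / 1) / 2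
      + (L\<^sub>0 + c\<^sub>1) * s * (\<rho> * sq_norm_fun s v + sq_norm_fun s d / \<rho>) / 2
      + (L\<^sub>0 + c\<^sub>1) * s * (1 / \<rho> * sq_norm_fun s d + sq_norm_fun s v / (1 / \<rho>)) / 2
      + (L\<^sub>0 + c\<^sub>1) * s * (1 * sq_norm_fun s d + sq_norm_fun s d / 1) / 2
      = s * ((c\<^sub>1 + (L\<^sub>0 + c\<^sub>1)) * \<rho> * sq_norm_fun s v + (L\<^sub>0 + c\<^sub>1) * (1 / \<rho> + 1) * sq_norm_fun s d)"
    using \<rho> by (simp add: field_simps)
  ultimately show ?thesis unfolding d_def[symmetric] by linarith
qed

text \<open>\<open>N_le\<close> compares noise and signal only after summation, like the trace ratio
  from which it will come, so the rows are added before the two are compared.\<close>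

lemma sum_bilin_perturbation:
  fixes c\<^sub>1 c\<^sub>2 L\<^sub>0 \<rho> lam :: real and q s :: nat
  assumes \<rho>: "0 < \<rho>" "\<rho> \<le> 1" and lam: "lam > 0" and c: "c\<^sub>1 \<ge> 0" "c\<^sub>2 \<ge> 0" "L\<^sub>0 \<ge> 0"
    and Sh: "\<And>a b. a < s \<Longrightarrow> b < s \<Longrightarrow> \<bar>Sh a b - Sg a b\<bar> \<le> c\<^sub>1 * \<rho>"
    and Sg: "\<And>a b. a < s \<Longrightarrow> b < s \<Longrightarrow> \<bar>Sg a b\<bar> \<le> L\<^sub>0"
    and G: "\<And>v. bilin s G v v \<ge> lam / 2 * sq_norm_fun s v"
    and N: "\<And>i a. i < q \<Longrightarrow> a < s \<Longrightarrow> (\<Sum>b<s. (Bh i b - B i b) * G b a) = N i a"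
    and N_le: "(\<Sum>i<q. sq_norm_fun s (N i)) \<le> c\<^sub>2 * \<rho>\<^sup>2 * (\<Sum>i<q. sq_norm_fun s (B i))"
  shows "\<bar>(\<Sum>i<q. bilin s Sh (Bh i) (Bh i)) - (\<Sum>i<q. bilin s Sg (B i) (B i))\<bar>
    \<le> s * (c\<^sub>1 + (L\<^sub>0 + c\<^sub>1) * (1 + 8 * c\<^sub>2 / lam\<^sup>2)) * \<rho> * (\<Sum>i<q. sq_norm_fun s (B i))"
proof -
  define SB where "SB = (\<Sum>i<q. sq_norm_fun s (B i))"
  define SD where "SD = (\<Sum>i<q. sq_norm_fun s (\<lambda>a. Bh i a - B i a))"
  define L where "L = L\<^sub>0 + c\<^sub>1"
  have L: "L \<ge> 0" using c by (simp add: L_def)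
  have SB: "SB \<ge> 0" by (simp add: SB_def sum_nonneg)
  have "SD \<le> (\<Sum>i<q. 4 / lam\<^sup>2 * sq_norm_fun s (N i))"
    unfolding SD_def by (intro sum_mono sq_norm_solution_le[OF lam G] N) auto
  also have "\<dots> \<le> 4 / lam\<^sup>2 * (c\<^sub>2 * \<rho>\<^sup>2 * SB)"
    unfolding sum_distrib_left[symmetric] SB_def using N_le by (intro mult_left_mono) auto
  finally have SD: "SD \<le> 4 / lam\<^sup>2 * (c\<^sub>2 * \<rho>\<^sup>2 * SB)" .
  \<comment> \<open>The squared error carries \<open>\<rho>\<^sup>2\<close>; the weight 1 / \<rho>
    of the cross terms uses up one power and leaves the rate \<rho>. The bound
    \<open>1 + \<rho> \<le> 2\<close> turns 4 into 8.\<close>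
  have "(1 / \<rho> + 1) * SD \<le> (1 / \<rho> + 1) * (4 / lam\<^sup>2 * (c\<^sub>2 * \<rho>\<^sup>2 * SB))"
    using SD \<rho> by (intro mult_left_mono) auto
  also have "\<dots> = ((1 / \<rho> + 1) * \<rho>\<^sup>2) * (4 / lam\<^sup>2 * (c\<^sub>2 * SB))" by (simp only: mult_ac)
  also have "(1 / \<rho> + 1) * \<rho>\<^sup>2 = (1 + \<rho>) * \<rho>"
    using \<rho> by (simp add: power2_eq_square field_simps)
  also have "(1 + \<rho>) * \<rho> * (4 / lam\<^sup>2 * (c\<^sub>2 * SB)) = (1 + \<rho>) * (4 / lam\<^sup>2 * (c\<^sub>2 * \<rho> * SB))"
    by (simp only: mult_ac)
  also have "\<dots> \<le> 2 * (4 / lam\<^sup>2 * (c\<^sub>2 * \<rho> * SB))"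
    using \<rho> c SB by (intro mult_right_mono) auto
  finally have D: "(1 / \<rho> + 1) * SD \<le> 8 * c\<^sub>2 / lam\<^sup>2 * \<rho> * SB" by simp
  have "\<bar>(\<Sum>i<q. bilin s Sh (Bh i) (Bh i)) - (\<Sum>i<q. bilin s Sg (B i) (B i))\<bar>
      \<le> (\<Sum>i<q. \<bar>bilin s Sh (Bh i) (Bh i) - bilin s Sg (B i) (B i)\<bar>)"
    by (simp add: sum_abs flip: sum_subtractf)
  also have "\<dots> \<le> (\<Sum>i<q. s * ((c\<^sub>1 + L) * \<rho> * sq_norm_fun s (B i)
     + L * (1 / \<rho> + 1) * sq_norm_fun s (\<lambda>a. Bh i a - B i a)))"
    unfolding L_def by (intro sum_mono bilin_self_perturbation \<rho> c Sh Sg)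
  also have "\<dots> = s * ((c\<^sub>1 + L) * \<rho> * SB + L * ((1 / \<rho> + 1) * SD))"
    by (simp add: SB_def SD_def sum.distrib mult.assoc flip: sum_distrib_left)
  also have "\<dots> \<le> s * ((c\<^sub>1 + L) * \<rho> * SB + L * (8 * c\<^sub>2 / lam\<^sup>2 * \<rho> * SB))"
    using D L by (intro mult_left_mono add_left_mono) auto
  also have "\<dots> = s * (c\<^sub>1 + L * (1 + 8 * c\<^sub>2 / lam\<^sup>2)) * \<rho> * SB" by (simp add: algebra_simps)
  finally show ?thesis unfolding SB_def L_def .
qed

text \<open>Writing the factor \<open>t / (t - 1)\<close> as \<open>1 + 1 / (t - 1)\<close> makes
  the normalisation by \<open>t - 1\<close> a perturbation of the plain empirical
  covariance.\<close>

lemma sample_cov_eq: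
  fixes x y :: "nat \<Rightarrow> real" and t :: nat
  assumes t: "t > 1"
  defines "mx \<equiv> (\<Sum>l<t. x l) / t" and "my \<equiv> (\<Sum>l<t. y l) / t"
  shows "1 / (real t - 1) * (\<Sum>l<t. (x l - mx) * (y l - my))
    = (1 + 1 / (real t - 1)) * ((\<Sum>l<t. x l * y l) / t - mx * my)"
proof -
  have sx: "(\<Sum>l<t. x l) = t * mx" and sy: "(\<Sum>l<t. y l) = t * my"
    using t by (auto simp: mx_def my_def)
  have "(\<Sum>l<t. (x l - mx) * (y l - my))
      = (\<Sum>l<t. x l * y l) - (\<Sum>l<t. x l) * my - mx * (\<Sum>l<t. y l) + t * (mx * my)"
    by (simp add: algebra_simps sum.distrib sum_subtractf flip: sum_distrib_left sum_distrib_right)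
  also have "\<dots> = (\<Sum>l<t. x l * y l) - t * (mx * my)" by (simp add: sx sy)
  also have "\<dots> = t * ((\<Sum>l<t. x l * y l) / t - mx * my)" using t by (simp add: field_simps)
  finally have "1 / (real t - 1) * (\<Sum>l<t. (x l - mx) * (y l - my))
      = (1 / (real t - 1) * t) * ((\<Sum>l<t. x l * y l) / t - mx * my)" by simp
  also have "1 / (real t - 1) * t = 1 + 1 / (real t - 1)" using t by (simp add: field_simps)
  finally show ?thesis .
qed

text \<open>The product of means is compared through
  \<open>x * y - m * m' = (x - m) * y + m * (y - m')\<close>. This error occurs twice in the
  constant: once directly, and once in the bound for the empirical covariance that multiplies
  \<open>1 / (t - 1)\<close>; there also \<open>L\<^sub>0\<close> enters.\<close>

lemma sample_cov_close:
  fixes \<rho> :: real and t :: nat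
  assumes \<rho>: "0 < \<rho>" "\<rho> \<le> 1" "1 / (real t - 1) \<le> \<rho>" and t: "t > 1"
    and G: "\<bar>g - l\<bar> \<le> e * \<rho>" and x: "\<bar>x - m\<bar> \<le> f * \<rho>" and y: "\<bar>y - m'\<bar> \<le> f * \<rho>"
    and m: "\<bar>m\<bar> \<le> m\<^sub>0" "\<bar>m'\<bar> \<le> m\<^sub>0" and L: "\<bar>l - m * m'\<bar> \<le> L\<^sub>0" and f: "f \<ge> 0" and e: "e \<ge> 0"
  shows "\<bar>(1 + 1 / (real t - 1)) * (g - x * y) - (l - m * m')\<bar>
    \<le> (2 * (e + f * (2 * m\<^sub>0 + f)) + L\<^sub>0) * \<rho>"
proof -
  let ?c = "e + f * (2 * m\<^sub>0 + f)"
  have m0: "m\<^sub>0 \<ge> 0" using m by linarith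
  have c0: "?c \<ge> 0" using e f m0 by simp
  have "\<bar>y\<bar> \<le> m\<^sub>0 + f" using y m mult_left_mono[OF \<rho>(2) f] by linarith
  hence "\<bar>(x - m) * y\<bar> \<le> (f * \<rho>) * (m\<^sub>0 + f)"
    unfolding abs_mult using x f \<rho> m0 by (intro mult_mono) auto
  moreover have "\<bar>m * (y - m')\<bar> \<le> m\<^sub>0 * (f * \<rho>)"
    unfolding abs_mult using y m m0 by (intro mult_mono) auto
  moreover have "(g - x * y) - (l - m * m') = (g - l) - (x - m) * y - m * (y - m')"
    by (simp add: algebra_simps)
  moreover have "?c * \<rho> = e * \<rho> + (f * \<rho>) * (m\<^sub>0 + f) + m\<^sub>0 * (f * \<rho>)" by (simp add: algebra_simps)
  ultimately have A: "\<bar>(g - x * y) - (l - m * m')\<bar> \<le> ?c * \<rho>" using G by linarith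
  moreover have "?c * \<rho> \<le> ?c" using c0 \<rho> by (simp add: mult_left_le)
  ultimately have "\<bar>g - x * y\<bar> \<le> ?c + L\<^sub>0" using L by linarith
  hence "\<bar>1 / (real t - 1) * (g - x * y)\<bar> \<le> \<rho> * (?c + L\<^sub>0)"
    unfolding abs_mult using \<rho> t by (intro mult_mono) auto
  moreover have "(2 * ?c + L\<^sub>0) * \<rho> = ?c * \<rho> + \<rho> * (?c + L\<^sub>0)" by (simp add: algebra_simps)
  moreover have "(1 + 1 / (real t - 1)) * (g - x * y) - (l - m * m')
    = ((g - x * y) - (l - m * m')) + 1 / (real t - 1) * (g - x * y)" by (simp add: algebra_simps)
  ultimately show ?thesis using A by linarith
qed

section \<open>Coercivity and real spectra of symmetric matrices\<close>

lemma bilin_mat_eq_scalar_prod: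
  assumes "A \<in> carrier_mat s s"
  shows "bilin s (\<lambda>a b. A $$ (a, b)) u v = vec s u \<bullet> (A *\<^sub>v vec s v)"
proof -
  have "vec s u \<bullet> (A *\<^sub>v vec s v) = (\<Sum>a<s. u a * (\<Sum>b<s. A $$ (a, b) * v b))"
    using assms by (auto simp: scalar_prod_def atLeast0LessThan intro!: sum.cong)
  thus ?thesis by (simp add: bilin_def sum_distrib_left mult_ac)
qed

lemma sq_norm_fun_eq_scalar_prod: "sq_norm_fun s v = vec s v \<bullet> vec s v"
  by (auto simp: sq_norm_fun_def scalar_prod_def atLeast0LessThan power2_eq_square)

lemma sq_norm_fun_vec_pos:
  assumes "v \<in> carrier_vec s" "v \<noteq> 0\<^sub>v s"
  shows "sq_norm_fun s (\<lambda>a. v $ a) > 0"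
proof -
  obtain a where a: "a < s" "v $ a \<noteq> 0"
    using assms by (metis carrier_vecD eq_vecI index_zero_vec(1) index_zero_vec(2))
  have "0 < (v $ a)\<^sup>2" using a by simp
  also have "\<dots> \<le> (\<Sum>a<s. (v $ a)\<^sup>2)" using a by (intro member_le_sum) auto
  finally show ?thesis by (simp add: sq_norm_fun_def)
qed

lemma det_nonzero_if_bilin_pos:
  assumes A: "A \<in> carrier_mat s s" and lam: "lam > 0"
    and pos: "\<And>v. bilin s (\<lambda>a b. A $$ (a, b)) v v \<ge> lam * sq_norm_fun s v"
  shows "det A \<noteq> 0"
proof
  assume "det A = 0"
  then obtain v where v: "v \<in> carrier_vec s" "v \<noteq> 0\<^sub>v s" "A *\<^sub>v v = 0\<^sub>v s"
    using det_0_iff_vec_prod_zero[OF A] by auto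
  have [simp]: "vec s (($) v) = v" using v by auto
  have "lam * sq_norm_fun s (\<lambda>a. v $ a) \<le> 0"
    using pos[of "\<lambda>a. v $ a"] v by (simp add: bilin_mat_eq_scalar_prod[OF A])
  thus False using mult_pos_pos[OF lam sq_norm_fun_vec_pos[OF v(1,2)]] by simp
qed

text \<open>In substance this is Cauchy-Schwarz for a semidefinite form, applied to \<open>v\<close>
  and \<open>w\<close>, the image of \<open>v\<close> under the inverse: the form is |v|^2 at
  \<open>(v, w)\<close> and at most \<open>c\<close> |v|^2 at \<open>(w, w)\<close>, hence at least
  |v|^2 / \<open>c\<close> at \<open>(v, v)\<close>.\<close>

lemma bilin_coercive_if_invertible:
  assumes A: "A \<in> carrier_mat s s" and inv: "invertible_mat A"
    and sym: "\<And>a b. a < s \<Longrightarrow> b < s \<Longrightarrow> A $$ (a, b) = A $$ (b, a)"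
    and psd: "\<And>v. bilin s (\<lambda>a b. A $$ (a, b)) v v \<ge> 0"
  shows "\<exists>lam>0. \<forall>v. bilin s (\<lambda>a b. A $$ (a, b)) v v \<ge> lam * sq_norm_fun s v"
proof -
  obtain W where "inverts_mat A W" "inverts_mat W A" using inv by (auto simp: invertible_mat_def)
  hence AW: "A * W = 1\<^sub>m s" and WA: "W * A = 1\<^sub>m (dim_row W)"
    using A by (auto simp: inverts_mat_def)
  have W: "W \<in> carrier_mat s s"
    using arg_cong[OF AW, of dim_col] arg_cong[OF WA, of dim_col] A by auto
  define e where "e = 1 + (\<Sum>a<s. \<Sum>b<s. \<bar>W $$ (a, b)\<bar>)"
  have e: "\<bar>W $$ (a, b)\<bar> \<le> e" if "a < s" "b < s" for a b
  proof -
    have "\<bar>W $$ (a, b)\<bar> \<le> (\<Sum>b<s. \<bar>W $$ (a, b)\<bar>)" using that by (intro member_le_sum) auto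
    also have "\<dots> \<le> (\<Sum>a<s. \<Sum>b<s. \<bar>W $$ (a, b)\<bar>)"
      using that by (intro member_le_sum[of a "{..<s}" "\<lambda>a. \<Sum>b<s. \<bar>W $$ (a, b)\<bar>"] sum_nonneg) auto
    finally show ?thesis by (simp add: e_def)
  qed
  have e0: "e > 0" unfolding e_def by (intro add_pos_nonneg sum_nonneg) auto
  \<comment> \<open>The summand 1 keeps \<open>c\<close> positive in dimension zero too.\<close>
  define c where "c = e * s + 1"
  have c0: "c > 0" unfolding c_def using e0 by (simp add: add_nonneg_pos)
  let ?b = "bilin s (\<lambda>a b. A $$ (a, b))"
  have "?b v v \<ge> (1 / c) * sq_norm_fun s v" for v
  proof -
    define w where "w = W *\<^sub>v vec s v"
    have w: "w \<in> carrier_vec s" using W by (simp add: w_def)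
    have ws: "vec s (\<lambda>a. w $ a) = w" using w by auto
    have Aw: "A *\<^sub>v w = vec s v"
      unfolding w_def using A W AW by (subst assoc_mult_mat_vec[symmetric]) auto
    have vw: "?b v (\<lambda>a. w $ a) = sq_norm_fun s v"
      by (simp add: bilin_mat_eq_scalar_prod[OF A] ws Aw sq_norm_fun_eq_scalar_prod)
    have wv: "?b (\<lambda>a. w $ a) v = ?b v (\<lambda>a. w $ a)"
      unfolding bilin_def by (subst sum.swap) (auto intro!: sum.cong simp: sym mult_ac)
    have "?b (\<lambda>a. w $ a) (\<lambda>a. w $ a) = vec s v \<bullet> w"
      using w by (simp add: bilin_mat_eq_scalar_prod[OF A] ws Aw comm_scalar_prod[of w s])
    also have "\<dots> = bilin s (\<lambda>a b. W $$ (a, b)) v v"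
      by (simp add: bilin_mat_eq_scalar_prod[OF W] w_def)
    also have "\<dots> \<le> e * s * (1 * sq_norm_fun s v + sq_norm_fun s v / 1) / 2"
      using abs_bilin_le[of s "\<lambda>a b. W $$ (a, b)" e 1 v v] e by simp
    also have "\<dots> \<le> c * sq_norm_fun s v" unfolding c_def by (simp add: algebra_simps)
    finally have ww: "?b (\<lambda>a. w $ a) (\<lambda>a. w $ a) \<le> c * sq_norm_fun s v" .
    \<comment> \<open>Positivity of the form at \<open>v - A\<inverse> v / c\<close> gives the bound.\<close>
    have "?b (\<lambda>a. v a - \<eta> * w $ a) (\<lambda>a. v a - \<eta> * w $ a)
        = ?b v v - \<eta> * ?b v (\<lambda>a. w $ a) - \<eta> * ?b (\<lambda>a. w $ a) v
          + \<eta>\<^sup>2 * ?b (\<lambda>a. w $ a) (\<lambda>a. w $ a)" for \<eta>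
      unfolding bilin_def sum_distrib_left sum_subtractf[symmetric] sum.distrib[symmetric]
      by (intro sum.cong refl) (simp add: algebra_simps power2_eq_square)
    from this[of "1 / c"]
    have "?b (\<lambda>a. v a - 1 / c * w $ a) (\<lambda>a. v a - 1 / c * w $ a)
        = ?b v v - 1 / c * ?b v (\<lambda>a. w $ a) - 1 / c * ?b (\<lambda>a. w $ a) v
          + (1 / c)\<^sup>2 * ?b (\<lambda>a. w $ a) (\<lambda>a. w $ a)" .
    also have "\<dots> \<le> ?b v v - 2 * (1 / c * sq_norm_fun s v) + (1 / c)\<^sup>2 * (c * sq_norm_fun s v)"
      unfolding wv vw using mult_left_mono[OF ww, of "(1 / c)\<^sup>2"] by simp
    also have "(1 / c)\<^sup>2 * (c * sq_norm_fun s v) = 1 / c * sq_norm_fun s v"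
      using c0 by (simp add: power2_eq_square)
    finally show ?thesis using psd[of "\<lambda>a. v a - 1 / c * w $ a"] by linarith
  qed
  thus ?thesis using c0 by (intro exI[of _ "1 / c"]) auto
qed

text \<open>A complex eigenvector \<open>x + i y\<close> exists. Symmetry equates the pairings of
  \<open>y\<close> with \<open>A x\<close> and of \<open>x\<close> with \<open>A y\<close>, which
  forces the imaginary part of the eigenvalue, times |x|^2 + |y|^2, to vanish. Then \<open>x\<close>
  or \<open>y\<close> is a real eigenvector.\<close>

lemma symmetric_real_mat_spectrum_nonempty:
  fixes A :: "real mat"
  assumes A: "A \<in> carrier_mat s s" and s: "s > 0"
    and sym: "\<And>a b. a < s \<Longrightarrow> b < s \<Longrightarrow> A $$ (a, b) = A $$ (b, a)"
  shows "spectrum A \<noteq> {}"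
proof -
  let ?C = "map_mat complex_of_real A"
  have C: "?C \<in> carrier_mat s s" using A by simp
  obtain k where "k \<in> spectrum ?C" using spectrum_non_empty[OF C s] by auto
  then obtain v where v: "v \<in> carrier_vec s" "v \<noteq> 0\<^sub>v s" "?C *\<^sub>v v = k \<cdot>\<^sub>v v"
    using A by (auto simp: spectrum_def eigenvalue_def eigenvector_def)
  define x where "x = (\<lambda>a. Re (v $ a))"
  define y where "y = (\<lambda>a. Im (v $ a))"
  have comp: "(\<Sum>b<s. complex_of_real (A $$ (a, b)) * v $ b) = k * v $ a" if "a < s" for a
  proof -
    have "(?C *\<^sub>v v) $ a = (k \<cdot>\<^sub>v v) $ a" using v by simp
    thus ?thesis using that A carrier_vecD[OF v(1)] by (simp add: scalar_prod_def atLeast0LessThan)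
  qed
  have Ax: "(\<Sum>b<s. A $$ (a, b) * x b) = Re k * x a - Im k * y a" if "a < s" for a
    using arg_cong[OF comp[OF that], of Re] by (simp add: x_def y_def)
  have Ay: "(\<Sum>b<s. A $$ (a, b) * y b) = Re k * y a + Im k * x a" if "a < s" for a
    using arg_cong[OF comp[OF that], of Im] by (simp add: x_def y_def)
  have "(\<Sum>a<s. y a * (\<Sum>b<s. A $$ (a, b) * x b)) = (\<Sum>a<s. x a * (\<Sum>b<s. A $$ (a, b) * y b))"
    unfolding sum_distrib_left by (subst sum.swap) (auto intro!: sum.cong simp: sym mult_ac)
  hence "(\<Sum>a<s. y a * (Re k * x a - Im k * y a)) = (\<Sum>a<s. x a * (Re k * y a + Im k * x a))"
    by (simp add: Ax Ay)
  hence "0 = (\<Sum>a<s. x a * (Re k * y a + Im k * x a) - y a * (Re k * x a - Im k * y a))"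
    by (simp add: sum_subtractf)
  also have "\<dots> = Im k * (\<Sum>a<s. (x a)\<^sup>2 + (y a)\<^sup>2)"
    by (simp add: sum_distrib_left algebra_simps power2_eq_square)
  finally have "Im k * (\<Sum>a<s. (x a)\<^sup>2 + (y a)\<^sup>2) = 0" ..
  moreover obtain a where a: "a < s" "v $ a \<noteq> 0"
    using v by (metis carrier_vecD eq_vecI index_zero_vec(1) index_zero_vec(2))
  have "0 < (x a)\<^sup>2 + (y a)\<^sup>2" using a by (simp add: x_def y_def complex_eq_iff sum_power2_gt_zero_iff)
  hence "0 < (\<Sum>a<s. (x a)\<^sup>2 + (y a)\<^sup>2)" using a by (intro sum_pos2[of _ a]) auto
  ultimately have k: "Im k = 0" by auto
  have ev: "eigenvalue A (Re k)" if "a < s" "u a \<noteq> 0" "\<And>a. a < s \<Longrightarrow> (\<Sum>b<s. A $$ (a, b) * u b) = Re k * u a" for u a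
    unfolding eigenvalue_def eigenvector_def
  proof (intro exI[of _ "vec s u"] conjI)
    show "vec s u \<noteq> 0\<^sub>v (dim_row A)" 
    proof
      assume "vec s u = 0\<^sub>v (dim_row A)"
      from arg_cong[OF this, of "\<lambda>w. w $ a"] show False using that(1,2) A by simp
    qed
    show "A *\<^sub>v vec s u = Re k \<cdot>\<^sub>v vec s u"
      using A that(3) by (intro eq_vecI) (auto simp: scalar_prod_def atLeast0LessThan)
  qed (use A in auto)
  have "x a \<noteq> 0 \<or> y a \<noteq> 0" using a by (simp add: x_def y_def complex_eq_iff)
  hence "eigenvalue A (Re k)"
    using ev[of a x] ev[of a y] a Ax Ay k by auto
  thus ?thesis by (auto simp: spectrum_def)
qed

text \<open>Coercivity makes every real eigenvalue positive. Finiteness and nonemptiness of the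
  spectrum give \<open>Max\<close> and \<open>Min\<close> their intended meaning.\<close>

lemma condition_number_ge_1:
  assumes A: "A \<in> carrier_mat s s" and s: "s > 0"
    and sym: "\<And>a b. a < s \<Longrightarrow> b < s \<Longrightarrow> A $$ (a, b) = A $$ (b, a)"
    and lam: "lam > 0" and pos: "\<And>v. bilin s (\<lambda>a b. A $$ (a, b)) v v \<ge> lam * sq_norm_fun s v"
  shows "condition_number A \<ge> 1"
proof -
  have fin: "finite (spectrum A)" using card_finite_spectrum[OF A] by simp
  have ne: "spectrum A \<noteq> {}" using symmetric_real_mat_spectrum_nonempty[OF A s sym] .
  have "k > 0" if k: "k \<in> spectrum A" for k
  proof -
    obtain v where v: "v \<in> carrier_vec s" "v \<noteq> 0\<^sub>v s" "A *\<^sub>v v = k \<cdot>\<^sub>v v"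
      using k A by (auto simp: spectrum_def eigenvalue_def eigenvector_def)
    have [simp]: "vec s (($) v) = v" using v by auto
    have sq: "sq_norm_fun s (\<lambda>a. v $ a) > 0" by (rule sq_norm_fun_vec_pos[OF v(1,2)])
    have "lam * sq_norm_fun s (\<lambda>a. v $ a) \<le> k * sq_norm_fun s (\<lambda>a. v $ a)"
      using pos[of "\<lambda>a. v $ a"] v by (simp add: bilin_mat_eq_scalar_prod[OF A] sq_norm_fun_eq_scalar_prod)
    thus ?thesis using sq lam by simp
  qed
  hence "Min (spectrum A) > 0" using fin ne by simp
  moreover have "Min (spectrum A) \<le> Max (spectrum A)" using fin ne by simp
  ultimately show ?thesis by (simp add: condition_number_def)
qed

section \<open>Matrices and estimators\<close>

lemma index_mult_mat_sum:
  assumes "A \<in> carrier_mat n m" "B \<in> carrier_mat m p" "i < n" "j < p"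
  shows "(A * B) $$ (i, j) = (\<Sum>l<m. A $$ (i, l) * B $$ (l, j))"
  using assms by (simp add: scalar_prod_def atLeast0LessThan)

text \<open>\<open>mat_inverse\<close> is defined by an elimination algorithm. Cramer's formula
  shows that its entries are rational functions of the entries of \<open>A\<close>, from which
  measurability of the estimator follows.\<close>

lemma minv_eq_adj_mat:
  assumes A: "A \<in> carrier_mat s s"
  shows "minv A = (if det A = 0 then 0\<^sub>m s s else (1 / det A) \<cdot>\<^sub>m adj_mat A)"
proof (cases "det A = 0")
  case True
  have "mat_inverse A = None"
  proof (cases "mat_inverse A")
    case (Some B)
    hence "A * B = 1\<^sub>m s" "B \<in> carrier_mat s s" using mat_inverse(2)[OF A] by auto
    hence "det A * det B = 1" using det_mult[OF A, of B] by simp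
    thus ?thesis using True by simp
  qed
  thus ?thesis using A True by (simp add: minv_def)
next
  case False
  have "mat_inverse A \<noteq> None"
    using mat_inverse(1)[OF A, of "()"] det_non_zero_imp_unit[OF A False, of "()"] by blast
  then obtain B where B: "mat_inverse A = Some B" by auto
  hence BA: "B * A = 1\<^sub>m s" and Bc: "B \<in> carrier_mat s s" using mat_inverse(2)[OF A] by auto
  note adj = adj_mat[OF A]
  have "(1 / det A) \<cdot>\<^sub>m adj_mat A = B * A * ((1 / det A) \<cdot>\<^sub>m adj_mat A)" using adj BA by simp
  also have "\<dots> = B * ((1 / det A) \<cdot>\<^sub>m (A * adj_mat A))"
    using A Bc adj by (simp add: assoc_mult_mat[of _ s s _ s _ s] mult_smult_distrib)
  also have "\<dots> = B" unfolding adj(2) using Bc False by (intro eq_matI) auto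
  finally show ?thesis using False B by (simp add: minv_def)
qed

lemma minv_right_inverse:
  assumes A: "A \<in> carrier_mat s s" and "det A \<noteq> 0"
  shows "minv A \<in> carrier_mat s s" "A * minv A = 1\<^sub>m s"
proof -
  have "mat_inverse A \<noteq> None"
    using mat_inverse(1)[OF A, of "()"] det_non_zero_imp_unit[OF A assms(2), of "()"] by blast
  thus "minv A \<in> carrier_mat s s" "A * minv A = 1\<^sub>m s"
    using mat_inverse(2)[OF A] by (auto simp: minv_def)
qed

lemma borel_measurable_det:
  fixes A :: "'w \<Rightarrow> real mat"
  assumes A: "\<And>\<omega>. A \<omega> \<in> carrier_mat s s"
    and meas: "\<And>a b. a < s \<Longrightarrow> b < s \<Longrightarrow> (\<lambda>\<omega>. A \<omega> $$ (a, b)) \<in> borel_measurable M"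
  shows "(\<lambda>\<omega>. det (A \<omega>)) \<in> borel_measurable M"
proof -
  have "(\<lambda>\<omega>. A \<omega> $$ (i, p i)) \<in> borel_measurable M" if "p permutes {0..<s}" "i \<in> {0..<s}" for p i
    using permutes_in_image[OF that(1), of i] that(2) by (intro meas) auto
  thus ?thesis unfolding det_def'[OF A] by auto
qed

lemma borel_measurable_minv:
  fixes A :: "'w \<Rightarrow> real mat"
  assumes A: "\<And>\<omega>. A \<omega> \<in> carrier_mat s s"
    and meas: "\<And>a b. a < s \<Longrightarrow> b < s \<Longrightarrow> (\<lambda>\<omega>. A \<omega> $$ (a, b)) \<in> borel_measurable M"
    and ab: "a < s" "b < s"
  shows "(\<lambda>\<omega>. minv (A \<omega>) $$ (a, b)) \<in> borel_measurable M"
proof -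
  have [measurable]: "(\<lambda>\<omega>. det (A \<omega>)) \<in> borel_measurable M"
    by (rule borel_measurable_det[OF A meas])
  have dims: "dim_row (A \<omega>) = s" "dim_col (A \<omega>) = s" for \<omega> using A[of \<omega>] by auto
  have [measurable]: "(\<lambda>\<omega>. det (mat_delete (A \<omega>) b a)) \<in> borel_measurable M"
  proof (rule borel_measurable_det[of _ "s - 1"])
    show "mat_delete (A \<omega>) b a \<in> carrier_mat (s - 1) (s - 1)" for \<omega>
      by (simp add: mat_delete_def dims)
    fix i j assume "i < s - 1" "j < s - 1"
    thus "(\<lambda>\<omega>. mat_delete (A \<omega>) b a $$ (i, j)) \<in> borel_measurable M"
      by (auto simp: mat_delete_def dims intro!: meas)
  qed
  have "minv (A \<omega>) $$ (a, b)
      = (if det (A \<omega>) = 0 then 0 else 1 / det (A \<omega>) * ((-1) ^ (b + a) * det (mat_delete (A \<omega>) b a)))" for \<omega>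
    using ab by (simp add: minv_eq_adj_mat[OF A] adj_mat_def dims cofactor_def)
  thus ?thesis by simp
qed

text \<open>With \<open>D = Q * B\<close> the trace is that of \<open>Sig * D\<^sup>T * D\<close>,
  the sum of the form \<open>Sig\<close> over the rows of \<open>D\<close>. From here on
  \<open>k\<close> matters only inside the entries of \<open>Q * B\<close>.\<close>

lemma trace_form_eq_sum_bilin:
  assumes Sig: "Sig \<in> carrier_mat s s" and B: "B \<in> carrier_mat k s" and Q: "Q \<in> carrier_mat q k"
  shows "trace_form Sig B Q
    = (\<Sum>i<q. bilin s (\<lambda>a b. Sig $$ (a, b)) (\<lambda>a. (Q * B) $$ (i, a)) (\<lambda>a. (Q * B) $$ (i, a)))"
proof -
  let ?D = "Q * B"
  have D: "?D \<in> carrier_mat q s" using Q B by simp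
  have "Sig * B\<^sup>T * Q\<^sup>T * Q * B = (Sig * ?D\<^sup>T) * ?D"
  proof -
    have "Sig * B\<^sup>T * Q\<^sup>T = Sig * ?D\<^sup>T"
      using Sig B Q by (subst transpose_mult[OF Q B]) (intro assoc_mult_mat; auto)
    moreover have "Sig * ?D\<^sup>T * Q * B = Sig * ?D\<^sup>T * (Q * B)"
      using Sig B Q D by (intro assoc_mult_mat) auto
    ultimately show ?thesis by simp
  qed
  moreover have "(Sig * E\<^sup>T * E) $$ (a, a) = (\<Sum>i<q. (\<Sum>b<s. Sig $$ (a, b) * E $$ (i, b)) * E $$ (i, a))"
    if "E \<in> carrier_mat q s" "a < s" for E a
    using Sig that by (simp add: scalar_prod_def atLeast0LessThan del: assoc_mult_mat)
  ultimately have "trace_form Sig B Q = (\<Sum>a<s. \<Sum>i<q. (\<Sum>b<s. Sig $$ (a, b) * ?D $$ (i, b)) * ?D $$ (i, a))"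
    unfolding trace_form_def mtrace_def using Sig D by (simp del: index_mult_mat(1) assoc_mult_mat)
  also have "\<dots> = (\<Sum>i<q. \<Sum>a<s. (\<Sum>b<s. Sig $$ (a, b) * ?D $$ (i, b)) * ?D $$ (i, a))"
    by (rule sum.swap)
  finally show ?thesis by (simp add: bilin_def sum_distrib_left sum_distrib_right mult_ac)
qed

lemma mtrace_gram:
  assumes B: "B \<in> carrier_mat k s" and Q: "Q \<in> carrier_mat q k"
  shows "mtrace (Q * B * B\<^sup>T * Q\<^sup>T) = (\<Sum>i<q. sq_norm_fun s (\<lambda>a. (Q * B) $$ (i, a)))"
proof -
  have D: "Q * B \<in> carrier_mat q s" using Q B by simp
  have "Q * B * B\<^sup>T * Q\<^sup>T = Q * B * (Q * B)\<^sup>T"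
    using B Q D by (subst transpose_mult[OF Q B]) (intro assoc_mult_mat; auto)
  moreover have "mtrace (E * E\<^sup>T) = (\<Sum>i<q. sq_norm_fun s (\<lambda>a. E $$ (i, a)))" if "E \<in> carrier_mat q s" for E
    using that by (auto simp: mtrace_def sq_norm_fun_def scalar_prod_def atLeast0LessThan power2_eq_square
        intro!: sum.cong)
  ultimately show ?thesis using D by simp
qed

text \<open>The summands are the variances of the coordinates of \<open>Q\<close> applied to a noise
  vector with covariance \<Gamma>.\<close>

lemma mtrace_congruence:
  assumes \<Gamma>: "\<Gamma> \<in> carrier_mat k k" and Q: "Q \<in> carrier_mat q k"
  shows "mtrace (Q * \<Gamma> * Q\<^sup>T) = (\<Sum>i<q. row Q i \<bullet> (\<Gamma> *\<^sub>v row Q i))"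
proof -
  have "(Q * \<Gamma> * Q\<^sup>T) $$ (i, i) = row Q i \<bullet> (\<Gamma> *\<^sub>v row Q i)" if "i < q" for i
  proof -
    have "Q * \<Gamma> * Q\<^sup>T = Q * (\<Gamma> * Q\<^sup>T)" using \<Gamma> Q by (intro assoc_mult_mat) auto
    moreover have "col (\<Gamma> * Q\<^sup>T) i = \<Gamma> *\<^sub>v row Q i"
      using that \<Gamma> Q by (intro eq_vecI) auto
    ultimately show ?thesis using that \<Gamma> Q by simp
  qed
  thus ?thesis using Q by (simp add: mtrace_def)
qed

text \<open>Multiplication by the Gram matrix removes the inverse: the Gram matrix is symmetric, so
  the transpose of its right inverse is a left inverse.\<close>

lemma normal_equations:
  assumes Z: "Z \<in> carrier_mat t s" and Y: "Y \<in> carrier_mat k t" and Q: "Q \<in> carrier_mat q k"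
    and det: "det (Z\<^sup>T * Z) \<noteq> 0"
  shows "(Q * (Y * (left_pinv Z)\<^sup>T)) * (Z\<^sup>T * Z) = Q * (Y * Z)"
proof -
  let ?A = "Z\<^sup>T * Z"
  have A: "?A \<in> carrier_mat s s" using Z by simp
  note W = minv_right_inverse[OF A det]
  have symA: "?A\<^sup>T = ?A" using Z by (subst transpose_mult[of _ s t]) auto
  have "(left_pinv Z)\<^sup>T = Z * (minv ?A)\<^sup>T"
    unfolding left_pinv_def using Z W by (subst transpose_mult[of _ s s]) auto
  moreover have "(minv ?A)\<^sup>T * ?A = 1\<^sub>m s"
    using transpose_mult[OF A W(1)] W symA by simp
  moreover have "Z * (minv ?A)\<^sup>T * ?A = Z * ((minv ?A)\<^sup>T * ?A)"
    using Z W A by (intro assoc_mult_mat) auto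
  ultimately have *: "(left_pinv Z)\<^sup>T * ?A = Z" using Z by simp
  have P: "(left_pinv Z)\<^sup>T \<in> carrier_mat t s" using Z W by (simp add: left_pinv_def)
  have "(Q * (Y * (left_pinv Z)\<^sup>T)) * ?A = Q * ((Y * (left_pinv Z)\<^sup>T) * ?A)"
    using Q Y P A by (intro assoc_mult_mat) auto
  also have "(Y * (left_pinv Z)\<^sup>T) * ?A = Y * ((left_pinv Z)\<^sup>T * ?A)"
    using Y P A by (intro assoc_mult_mat) auto
  finally show ?thesis by (simp add: *)
qed

text \<open>Here \<open>L\<^sub>0\<close> bounds the entries of the covariance matrix, \<open>c\<^sub>1 * \<rho>\<close> the error of the sample
  covariance and \<open>D\<close> the ratio of noise to signal, when \<open>c\<close> is a sub-Gaussian scale of the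
  regressors and \<open>lam\<close> a lower bound of the covariance form.\<close>

definition error_const :: "nat \<Rightarrow> real \<Rightarrow> real \<Rightarrow> real \<Rightarrow> real" where
  "error_const s c lam D =
     (let L\<^sub>0 = 18 * c\<^sup>2; c\<^sub>1 = 2 * (11 * c\<^sup>2 + 22 * c * (2 * (4 * c) + 22 * c)) + L\<^sub>0
      in s * (c\<^sub>1 + (L\<^sub>0 + c\<^sub>1) * (1 + 8 * (s * (22 * c)\<^sup>2 * D) / lam\<^sup>2)) / lam)"

lemma error_const_pos:
  assumes "s > 0" "c > 0" "lam > 0" "D \<ge> 0"
  shows "error_const s c lam D > 0"
  unfolding error_const_def Let_def using assms
  by (intro divide_pos_pos mult_pos_pos add_pos_pos add_pos_nonneg divide_nonneg_nonneg mult_nonneg_nonneg) auto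

text \<open>The bounds are those for means of variables of scale \<open>c\<^sup>2\<close> (products
  of regressors) and \<open>2 * c\<close> (single regressors);
  \<open>18 = 2 + 4 * 4\<close>.\<close>

lemma abs_diff_mult_le:
  fixes l m m' c :: real
  assumes "\<bar>l\<bar> \<le> 2 * c\<^sup>2" "\<bar>m\<bar> \<le> 4 * c" "\<bar>m'\<bar> \<le> 4 * c"
  shows "\<bar>l - m * m'\<bar> \<le> 18 * c\<^sup>2"
proof -
  have "\<bar>m * m'\<bar> \<le> (4 * c) * (4 * c)" unfolding abs_mult using assms by (intro mult_mono) auto
  also have "\<dots> = 16 * c\<^sup>2" by (simp add: power2_eq_square)
  finally show ?thesis using assms(1) by linarith
qed

section \<open>The estimators as algebraic functions of the observed values\<close>

lemma design_mat_gram: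
  assumes "a < card S" "b < card S"
  shows "((design_mat S t x)\<^sup>T * design_mat S t x) $$ (a, b)
    = (\<Sum>l<t. x l (sorted_list_of_set S ! a) * x l (sorted_list_of_set S ! b))"
  using assms by (simp add: design_mat_def sub_vec_def scalar_prod_def atLeast0LessThan)

lemma Sigma_hat_entry:
  fixes x :: "nat \<Rightarrow> nat \<Rightarrow> real"
  assumes "a < card S" "b < card S" "t > 1"
  defines "u \<equiv> (\<lambda>l a. x l (sorted_list_of_set S ! a))"
  shows "Sigma_hat S t x $$ (a, b) = (1 + 1 / (real t - 1)) *
    ((\<Sum>l<t. u l a * u l b) / t - ((\<Sum>l<t. u l a) / t) * ((\<Sum>l<t. u l b) / t))"
proof -
  have "Sigma_hat S t x $$ (a, b) = 1 / (real t - 1) *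
     (\<Sum>l<t. (u l a - (\<Sum>l<t. u l a) / t) * (u l b - (\<Sum>l<t. u l b) / t))"
    using assms(1,2) by (simp add: Sigma_hat_def x_hat_def sub_vec_def u_def)
  thus ?thesis using sample_cov_eq[OF assms(3), of "\<lambda>l. u l a" "\<lambda>l. u l b"] by simp
qed

text \<open>Subtracting \<open>Q * \<beta>\<close> times the Gram matrix from the normal equations
  leaves the residuals \<open>y - \<beta> x\<close> paired with the regressors. This is an identity
  between observed values; under the model the residuals are almost surely the noise.\<close>

lemma estimation_residual:
  fixes x y :: "nat \<Rightarrow> nat \<Rightarrow> real"
  assumes Q: "Q \<in> carrier_mat q k" and \<beta>: "\<beta> \<in> carrier_mat k (card S)"
    and det: "det ((design_mat S t x)\<^sup>T * design_mat S t x) \<noteq> 0"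
    and i: "i < q" and a: "a < card S"
  defines "u \<equiv> (\<lambda>l a. x l (sorted_list_of_set S ! a))"
  shows "(\<Sum>b<card S. ((Q * beta_hat S k t x y) $$ (i, b) - (Q * \<beta>) $$ (i, b)) * (\<Sum>l<t. u l b * u l a))
    = (\<Sum>l<t. (\<Sum>j<k. Q $$ (i, j) * (y l j - (\<Sum>b<card S. \<beta> $$ (j, b) * u l b))) * u l a)"
proof -
  let ?s = "card S" and ?Z = "design_mat S t x" and ?Y = "mat k t (\<lambda>(j, l). y l j)"
  have Z: "?Z \<in> carrier_mat t ?s" and Y: "?Y \<in> carrier_mat k t" by (auto simp: design_mat_def)
  have Zu: "?Z $$ (l, b) = u l b" if "l < t" "b < ?s" for l b
    using that by (simp add: design_mat_def sub_vec_def u_def)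
  have A: "?Z\<^sup>T * ?Z \<in> carrier_mat ?s ?s" using Z by simp
  have P: "(left_pinv ?Z)\<^sup>T \<in> carrier_mat t ?s"
    using Z minv_right_inverse(1)[OF A det] by (simp add: left_pinv_def)
  have bh: "Q * beta_hat S k t x y \<in> carrier_mat q ?s"
    using Q Y P by (auto simp: beta_hat_def)
  have "(\<Sum>b<?s. (Q * beta_hat S k t x y) $$ (i, b) * (\<Sum>l<t. u l b * u l a))
      = ((Q * beta_hat S k t x y) * (?Z\<^sup>T * ?Z)) $$ (i, a)"
    using a by (simp only: index_mult_mat_sum[OF bh A i a]) (intro sum.cong; simp add: design_mat_gram u_def)
  also have "\<dots> = (Q * (?Y * ?Z)) $$ (i, a)"
    unfolding beta_hat_def by (simp only: normal_equations[OF Z Y Q det])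
  also have "\<dots> = (\<Sum>j<k. Q $$ (i, j) * (\<Sum>l<t. y l j * u l a))"
  proof -
    have "?Y * ?Z \<in> carrier_mat k ?s" by (rule mult_carrier_mat[OF Y Z])
    moreover have "(?Y * ?Z) $$ (j, a) = (\<Sum>l<t. y l j * u l a)" if "j < k" for j
      using that a Y Z Zu by (simp add: scalar_prod_def atLeast0LessThan)
    ultimately show ?thesis using Q by (simp add: index_mult_mat_sum[OF Q _ i a] del: assoc_mult_mat index_mult_mat(1))
  qed
  also have "\<dots> = (\<Sum>l<t. (\<Sum>j<k. Q $$ (i, j) * y l j) * u l a)"
    unfolding sum_distrib_left sum_distrib_right by (subst sum.swap) (simp add: mult_ac)
  finally have 1: "(\<Sum>b<?s. (Q * beta_hat S k t x y) $$ (i, b) * (\<Sum>l<t. u l b * u l a))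
      = (\<Sum>l<t. (\<Sum>j<k. Q $$ (i, j) * y l j) * u l a)" .
  have Qb: "(Q * \<beta>) $$ (i, b) = (\<Sum>j<k. Q $$ (i, j) * \<beta> $$ (j, b))" if "b < ?s" for b
    using that i Q \<beta> by (simp add: scalar_prod_def atLeast0LessThan)
  have inner: "(\<Sum>b<?s. (Q * \<beta>) $$ (i, b) * u l b) = (\<Sum>j<k. Q $$ (i, j) * (\<Sum>b<?s. \<beta> $$ (j, b) * u l b))" for l
  proof -
    have "(\<Sum>b<?s. (Q * \<beta>) $$ (i, b) * u l b) = (\<Sum>b<?s. \<Sum>j<k. Q $$ (i, j) * \<beta> $$ (j, b) * u l b)"
      by (intro sum.cong refl) (simp add: Qb sum_distrib_right del: index_mult_mat(1))
    also have "\<dots> = (\<Sum>j<k. Q $$ (i, j) * (\<Sum>b<?s. \<beta> $$ (j, b) * u l b))"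
      by (subst sum.swap) (simp add: sum_distrib_left mult_ac)
    finally show ?thesis .
  qed
  have "(\<Sum>b<?s. (Q * \<beta>) $$ (i, b) * (\<Sum>l<t. u l b * u l a))
      = (\<Sum>l<t. (\<Sum>b<?s. (Q * \<beta>) $$ (i, b) * u l b) * u l a)"
    unfolding sum_distrib_left sum_distrib_right by (subst sum.swap) (simp add: mult_ac)
  also have "\<dots> = (\<Sum>l<t. (\<Sum>j<k. Q $$ (i, j) * (\<Sum>b<?s. \<beta> $$ (j, b) * u l b)) * u l a)"
    by (simp only: inner)
  finally have 2: "(\<Sum>b<?s. (Q * \<beta>) $$ (i, b) * (\<Sum>l<t. u l b * u l a))
      = (\<Sum>l<t. (\<Sum>j<k. Q $$ (i, j) * (\<Sum>b<?s. \<beta> $$ (j, b) * u l b)) * u l a)" .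
  show ?thesis
    unfolding left_diff_distrib sum_subtractf 1 2 right_diff_distrib ..
qed

text \<open>What remains at a single sample point once all deviations are small. The numbers
  \<open>\<sigma> i\<close> are noise scales of the rows, controlled only through their sum of
  squares. Coercivity bounds the true trace below by \<open>lam\<close> times the signal, which
  makes the error relative.\<close>

lemma trace_form_error_deterministic:
  fixes x y :: "nat \<Rightarrow> nat \<Rightarrow> real" and c lam D \<rho> :: real
  assumes Q: "Q \<in> carrier_mat q k" and \<beta>: "\<beta> \<in> carrier_mat k (card S)"
    and Sig: "Sig \<in> carrier_mat (card S) (card S)"
    and c: "c > 0" and lam: "lam > 0" and D: "D \<ge> 0"
    and \<rho>: "0 < \<rho>" "\<rho> \<le> 1" "1 / (real t - 1) \<le> \<rho>" "11 * c\<^sup>2 * \<rho> * card S \<le> lam / 2" and t: "t > 1"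
    and Sig_eq: "\<And>a b. a < card S \<Longrightarrow> b < card S \<Longrightarrow> Sig $$ (a, b) = L a b - m a * m b"
    and L: "\<And>a b. a < card S \<Longrightarrow> b < card S \<Longrightarrow> \<bar>L a b\<bar> \<le> 2 * c\<^sup>2"
    and m: "\<And>a. a < card S \<Longrightarrow> \<bar>m a\<bar> \<le> 4 * c"
    and pos: "\<And>v. bilin (card S) (\<lambda>a b. Sig $$ (a, b)) v v \<ge> lam * sq_norm_fun (card S) v"
    and \<sigma>: "(\<Sum>i<q. (\<sigma> i)\<^sup>2) \<le> D * (\<Sum>i<q. sq_norm_fun (card S) (\<lambda>a. (Q * \<beta>) $$ (i, a)))"
    and SB: "(\<Sum>i<q. sq_norm_fun (card S) (\<lambda>a. (Q * \<beta>) $$ (i, a))) > 0"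
  defines "u \<equiv> (\<lambda>l a. x l (sorted_list_of_set S ! a))"
  assumes G: "\<And>a b. a < card S \<Longrightarrow> b < card S \<Longrightarrow> \<bar>(\<Sum>l<t. u l a * u l b) / t - L a b\<bar> \<le> 11 * c\<^sup>2 * \<rho>"
    and X: "\<And>a. a < card S \<Longrightarrow> \<bar>(\<Sum>l<t. u l a) / t - m a\<bar> \<le> 22 * c * \<rho>"
    and N: "\<And>i a. i < q \<Longrightarrow> a < card S \<Longrightarrow>
      \<bar>(\<Sum>l<t. (\<Sum>j<k. Q $$ (i, j) * (y l j - (\<Sum>b<card S. \<beta> $$ (j, b) * u l b))) * u l a) / t\<bar>
        \<le> 22 * c * \<sigma> i * \<rho>"
  shows "\<bar>trace_form (Sigma_hat S t x) (beta_hat S k t x y) Q - trace_form Sig \<beta> Q\<bar>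
      / trace_form Sig \<beta> Q \<le> error_const (card S) c lam D * \<rho>"
proof -
  let ?s = "card S"
  let ?Z = "design_mat S t x"
  define GG where "GG = (\<lambda>a b. (\<Sum>l<t. u l a * u l b) / t)"
  define NN where "NN = (\<lambda>i a. (\<Sum>l<t. (\<Sum>j<k. Q $$ (i, j) * (y l j - (\<Sum>b<?s. \<beta> $$ (j, b) * u l b))) * u l a) / t)"
  define SB where "SB = (\<Sum>i<q. sq_norm_fun ?s (\<lambda>a. (Q * \<beta>) $$ (i, a)))"
  define L\<^sub>0 where "L\<^sub>0 = 18 * c\<^sup>2"
  define c\<^sub>1 where "c\<^sub>1 = 2 * (11 * c\<^sup>2 + 22 * c * (2 * (4 * c) + 22 * c)) + L\<^sub>0"
  define c\<^sub>2 where "c\<^sub>2 = ?s * (22 * c)\<^sup>2 * D"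
  \<comment> \<open>The second moment form dominates the covariance form.\<close>
  have posL: "bilin ?s L v v \<ge> lam * sq_norm_fun ?s v" for v
  proof -
    have "bilin ?s (\<lambda>a b. Sig $$ (a, b)) v v = bilin ?s (\<lambda>a b. L a b - m a * m b) v v"
      by (simp add: bilin_def Sig_eq)
    also have "\<dots> = bilin ?s L v v - bilin ?s (\<lambda>a b. m a * m b) v v" by (rule bilin_diff_form)
    also have "bilin ?s (\<lambda>a b. m a * m b) v v = (\<Sum>a<?s. m a * v a)\<^sup>2"
      by (simp add: bilin_def power2_eq_square sum_product mult_ac)
    finally show ?thesis using pos[of v] zero_le_power2[of "\<Sum>a<?s. m a * v a"] by linarith
  qed
  have posG: "bilin ?s GG v v \<ge> lam / 2 * sq_norm_fun ?s v" for v
    by (rule bilin_ge_of_close[OF posL, of _ "11 * c\<^sup>2 * \<rho>"]) (use G \<rho> in \<open>auto simp: GG_def\<close>)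
  have ZZ: "(?Z\<^sup>T * ?Z) $$ (a, b) = t * GG a b" if "a < ?s" "b < ?s" for a b
    using design_mat_gram[OF that, of t x] t by (simp add: GG_def u_def)
  have "?Z \<in> carrier_mat t ?s" by (simp add: design_mat_def)
  hence Zc: "?Z\<^sup>T * ?Z \<in> carrier_mat ?s ?s" by simp
  have det: "det (?Z\<^sup>T * ?Z) \<noteq> 0"
  proof (rule det_nonzero_if_bilin_pos[OF Zc])
    show "t * (lam / 2) > 0" using t lam by simp
    fix v
    have "bilin ?s (\<lambda>a b. (?Z\<^sup>T * ?Z) $$ (a, b)) v v = t * bilin ?s GG v v"
      by (simp add: bilin_def ZZ sum_distrib_left mult.assoc del: index_mult_mat(1))
    thus "bilin ?s (\<lambda>a b. (?Z\<^sup>T * ?Z) $$ (a, b)) v v \<ge> t * (lam / 2) * sq_norm_fun ?s v"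
      using mult_left_mono[OF posG[of v], of "real t"] by simp
  qed
  have Bh: "beta_hat S k t x y \<in> carrier_mat k ?s"
    using minv_right_inverse(1)[OF Zc det] by (auto simp: beta_hat_def left_pinv_def design_mat_def)
  have Shc: "Sigma_hat S t x \<in> carrier_mat ?s ?s" by (simp add: Sigma_hat_def)
  have Sg: "\<bar>Sig $$ (a, b)\<bar> \<le> L\<^sub>0" if "a < ?s" "b < ?s" for a b
    unfolding Sig_eq[OF that] L\<^sub>0_def using that by (intro abs_diff_mult_le L m)
  \<comment> \<open>The constant \<open>c\<^sub>1\<close> is that of \<open>sample_cov_close\<close>
    for second moment error \<open>11 * c\<^sup>2\<close>, mean error \<open>22 * c\<close> and
    means bounded by \<open>4 * c\<close>.\<close>
  have Sh: "\<bar>Sigma_hat S t x $$ (a, b) - Sig $$ (a, b)\<bar> \<le> c\<^sub>1 * \<rho>" if "a < ?s" "b < ?s" for a b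
    unfolding Sigma_hat_entry[OF that t] Sig_eq[OF that] c\<^sub>1_def
    using that c by (intro sample_cov_close \<rho> t G[unfolded u_def] X[unfolded u_def] m
        Sg[unfolded Sig_eq[OF that]]) (auto simp flip: Sig_eq intro!: Sg)
  have N_le: "(\<Sum>i<q. sq_norm_fun ?s (NN i)) \<le> c\<^sub>2 * \<rho>\<^sup>2 * SB"
  proof -
    have "(\<Sum>i<q. sq_norm_fun ?s (NN i)) \<le> (\<Sum>i<q. ?s * ((22 * c)\<^sup>2 * (\<sigma> i)\<^sup>2 * \<rho>\<^sup>2))"
    proof (intro sum_mono)
      fix i assume i: "i \<in> {..<q}"
      have "(NN i a)\<^sup>2 \<le> (22 * c)\<^sup>2 * (\<sigma> i)\<^sup>2 * \<rho>\<^sup>2" if "a < ?s" for a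
      proof -
        have "\<bar>NN i a\<bar> \<le> 22 * c * \<sigma> i * \<rho>" using N[of i a] i that by (simp only: NN_def lessThan_iff)
        from power_mono[OF this abs_ge_zero, of 2] show ?thesis by (simp add: power_mult_distrib)
      qed
      hence "sq_norm_fun ?s (NN i) \<le> (\<Sum>a<?s. (22 * c)\<^sup>2 * (\<sigma> i)\<^sup>2 * \<rho>\<^sup>2)"
        unfolding sq_norm_fun_def by (intro sum_mono) auto
      thus "sq_norm_fun ?s (NN i) \<le> ?s * ((22 * c)\<^sup>2 * (\<sigma> i)\<^sup>2 * \<rho>\<^sup>2)" by simp
    qed
    also have "\<dots> = (?s * (22 * c)\<^sup>2 * \<rho>\<^sup>2) * (\<Sum>i<q. (\<sigma> i)\<^sup>2)"
      unfolding sum_distrib_left by (intro sum.cong refl) (simp only: mult_ac)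
    also have "\<dots> \<le> (?s * (22 * c)\<^sup>2 * \<rho>\<^sup>2) * (D * SB)"
      unfolding SB_def by (intro mult_left_mono \<sigma>) auto
    also have "\<dots> = c\<^sub>2 * \<rho>\<^sup>2 * SB" unfolding c\<^sub>2_def by (simp only: mult_ac)
    finally show ?thesis .
  qed
  have eqN: "(\<Sum>b<?s. ((Q * beta_hat S k t x y) $$ (i, b) - (Q * \<beta>) $$ (i, b)) * GG b a) = NN i a"
    if "i < q" "a < ?s" for i a
  proof -
    have "(\<Sum>b<?s. ((Q * beta_hat S k t x y) $$ (i, b) - (Q * \<beta>) $$ (i, b)) * GG b a)
       = (\<Sum>b<?s. ((Q * beta_hat S k t x y) $$ (i, b) - (Q * \<beta>) $$ (i, b)) * (\<Sum>l<t. u l b * u l a)) / t"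
      unfolding GG_def times_divide_eq_right by (rule sum_divide_distrib[symmetric])
    thus ?thesis using estimation_residual[OF Q \<beta> det that, of y] by (simp only: NN_def u_def)
  qed
  have nn: "c\<^sub>1 \<ge> 0" "c\<^sub>2 \<ge> 0" "L\<^sub>0 \<ge> 0" using c D by (auto simp: c\<^sub>1_def c\<^sub>2_def L\<^sub>0_def)
  let ?T = "trace_form Sig \<beta> Q"
  have T: "?T \<ge> lam * SB"
    unfolding trace_form_eq_sum_bilin[OF Sig \<beta> Q] SB_def sum_distrib_left by (intro sum_mono pos)
  have SB0: "SB > 0" using SB by (simp add: SB_def)
  have T0: "?T > 0" using T mult_pos_pos[OF lam SB0] by linarith
  have "\<bar>trace_form (Sigma_hat S t x) (beta_hat S k t x y) Q - ?T\<bar>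
    \<le> ?s * (c\<^sub>1 + (L\<^sub>0 + c\<^sub>1) * (1 + 8 * c\<^sub>2 / lam\<^sup>2)) * \<rho> * SB"
    unfolding trace_form_eq_sum_bilin[OF Sig \<beta> Q] trace_form_eq_sum_bilin[OF Shc Bh Q] SB_def
    by (rule sum_bilin_perturbation[OF \<rho>(1,2) lam nn Sh Sg posG eqN N_le[unfolded SB_def]])
  also have "\<dots> = error_const ?s c lam D * \<rho> * (lam * SB)"
    using lam by (simp add: error_const_def Let_def c\<^sub>1_def[unfolded L\<^sub>0_def] c\<^sub>2_def L\<^sub>0_def)
  also have "\<dots> \<le> error_const ?s c lam D * \<rho> * ?T"
  proof (intro mult_left_mono T mult_nonneg_nonneg)
    show "0 \<le> error_const ?s c lam D"
      using nn lam unfolding error_const_def Let_def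
        c\<^sub>2_def[symmetric] L\<^sub>0_def[symmetric] c\<^sub>1_def[symmetric] by simp
  qed (use \<rho> in auto)
  finally show ?thesis using T0 by (simp add: pos_divide_le_eq)
qed

lemma sorted_list_of_set_nth_in:
  assumes "finite S" "a < card S"
  shows "sorted_list_of_set S ! a \<in> S"
  using assms by (metis nth_mem sorted_list_of_set.length_sorted_key_list_of_set set_sorted_list_of_set)

text \<open>The zero matrix that replaces a missing inverse has the right size, so the dimension is
  correct at every sample point, singular Gram matrix or not.\<close>

lemma beta_hat_carrier: "beta_hat S k t x y \<in> carrier_mat k (card S)"
proof -
  let ?Z = "design_mat S t x"
  have Z: "?Z \<in> carrier_mat t (card S)" by (simp add: design_mat_def)
  hence A: "?Z\<^sup>T * ?Z \<in> carrier_mat (card S) (card S)" by simp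
  have "minv (?Z\<^sup>T * ?Z) \<in> carrier_mat (card S) (card S)"
    unfolding minv_eq_adj_mat[OF A] using adj_mat(1)[OF A] by simp
  thus ?thesis using Z by (auto simp: beta_hat_def left_pinv_def)
qed

text \<open>Makes the error event measurable, so that its probability can be bounded below by that
  of the good event. The estimator is expanded into finite sums and products of sample entries and
  entries of \<open>minv\<close>.\<close>

lemma borel_measurable_trace_form_estimator:
  assumes S: "finite S" and Q: "Q \<in> carrier_mat q k"
    and Xs: "\<And>l i. l < t \<Longrightarrow> i \<in> S \<Longrightarrow> Xs l i \<in> borel_measurable P"
    and Fs: "\<And>l j. l < t \<Longrightarrow> j < k \<Longrightarrow> Fs l j \<in> borel_measurable P"
    and t: "t > 1"
  shows "(\<lambda>\<omega>. trace_form (Sigma_hat S t (\<lambda>l i. Xs l i \<omega>))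
      (beta_hat S k t (\<lambda>l i. Xs l i \<omega>) (\<lambda>l j. Fs l j \<omega>)) Q) \<in> borel_measurable P"
proof -
  let ?s = "card S"
  define u where "u = (\<lambda>l a. Xs l (sorted_list_of_set S ! a))"
  define Z where "Z = (\<lambda>\<omega>. design_mat S t (\<lambda>l i. Xs l i \<omega>))"
  have u [measurable]: "u l a \<in> borel_measurable P" if "l < t" "a < ?s" for l a
    unfolding u_def using that S by (intro Xs sorted_list_of_set_nth_in)
  have Z: "Z \<omega> \<in> carrier_mat t ?s" for \<omega> by (simp add: Z_def design_mat_def)
  have A: "(Z \<omega>)\<^sup>T * Z \<omega> \<in> carrier_mat ?s ?s" for \<omega> using Z[of \<omega>] by simp
  have gram: "((Z \<omega>)\<^sup>T * Z \<omega>) $$ (a, b) = (\<Sum>l<t. u l a \<omega> * u l b \<omega>)" if "a < ?s" "b < ?s" for \<omega> a b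
    unfolding Z_def u_def by (rule design_mat_gram[OF that])
  have minv [measurable]: "(\<lambda>\<omega>. minv ((Z \<omega>)\<^sup>T * Z \<omega>) $$ (a, b)) \<in> borel_measurable P"
    if "a < ?s" "b < ?s" for a b
    by (rule borel_measurable_minv[OF A _ that]) (simp add: gram u del: index_mult_mat(1))
  have mc: "minv ((Z \<omega>)\<^sup>T * Z \<omega>) \<in> carrier_mat ?s ?s" for \<omega>
    unfolding minv_eq_adj_mat[OF A] using adj_mat(1)[OF A] by simp
  have pinv: "left_pinv (Z \<omega>) $$ (a, l) = (\<Sum>b<?s. minv ((Z \<omega>)\<^sup>T * Z \<omega>) $$ (a, b) * u l b \<omega>)"
    if "a < ?s" "l < t" for a l \<omega>
  proof -
    have "Z \<omega> $$ (l, b) = u l b \<omega>" if "b < ?s" for b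
      using that \<open>l < t\<close> by (simp add: Z_def design_mat_def sub_vec_def u_def)
    thus ?thesis unfolding left_pinv_def using that Z[of \<omega>] mc[of \<omega>]
      by (simp add: scalar_prod_def atLeast0LessThan)
  qed
  have pc: "left_pinv (Z \<omega>) \<in> carrier_mat ?s t" for \<omega>
    using Z[of \<omega>] mc[of \<omega>] by (simp add: left_pinv_def)
  have bh: "beta_hat S k t (\<lambda>l i. Xs l i \<omega>) (\<lambda>l j. Fs l j \<omega>) $$ (j, a)
      = (\<Sum>l<t. Fs l j \<omega> * (\<Sum>b<?s. minv ((Z \<omega>)\<^sup>T * Z \<omega>) $$ (a, b) * u l b \<omega>))"
    if "j < k" "a < ?s" for j a \<omega>
  proof -
    have "design_mat S t (\<lambda>l i. Xs l i \<omega>) = Z \<omega>" by (simp add: Z_def)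
    thus ?thesis using that pc[of \<omega>] pinv[of a _ \<omega>]
      by (simp add: beta_hat_def scalar_prod_def atLeast0LessThan)
  qed
  define B where "B = (\<lambda>i a \<omega>. (Q * beta_hat S k t (\<lambda>l i. Xs l i \<omega>) (\<lambda>l j. Fs l j \<omega>)) $$ (i, a))"
  have B [measurable]: "B i a \<in> borel_measurable P" if "i < q" "a < ?s" for i a
  proof -
    have "B i a = (\<lambda>\<omega>. \<Sum>j<k. Q $$ (i, j) *
        (\<Sum>l<t. Fs l j \<omega> * (\<Sum>b<?s. minv ((Z \<omega>)\<^sup>T * Z \<omega>) $$ (a, b) * u l b \<omega>)))"
      unfolding B_def index_mult_mat_sum[OF Q beta_hat_carrier that]
      by (intro ext sum.cong refl) (simp add: bh that)
    thus ?thesis using that Fs u minv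
      by (auto intro!: borel_measurable_sum borel_measurable_times)
  qed
  have "trace_form (Sigma_hat S t (\<lambda>l i. Xs l i \<omega>)) (beta_hat S k t (\<lambda>l i. Xs l i \<omega>) (\<lambda>l j. Fs l j \<omega>)) Q
    = (\<Sum>i<q. \<Sum>a<?s. \<Sum>b<?s. ((1 + 1 / (real t - 1)) *
    ((\<Sum>l<t. u l a \<omega> * u l b \<omega>) / t - ((\<Sum>l<t. u l a \<omega>) / t) * ((\<Sum>l<t. u l b \<omega>) / t))) * B i a \<omega> * B i b \<omega>)" for \<omega>
  proof -
    have Shc: "Sigma_hat S t (\<lambda>l i. Xs l i \<omega>) \<in> carrier_mat ?s ?s" by (simp add: Sigma_hat_def)
    show ?thesis
      unfolding trace_form_eq_sum_bilin[OF Shc beta_hat_carrier Q] bilin_def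
      by (intro sum.cong refl) (simp add: Sigma_hat_entry[OF _ _ t] B_def u_def)
  qed
  thus ?thesis by (auto intro!: borel_measurable_sum borel_measurable_times borel_measurable_diff borel_measurable_divide u B)
qed

section \<open>Sub-Gaussian regressors\<close>

lemma sq_vnorm_rv_sub:
  "(vnorm (rv_sub S X \<omega>))\<^sup>2 = sq_norm_fun (card S) (\<lambda>a. X (sorted_list_of_set S ! a) \<omega>)"
proof -
  have "rv_sub S X \<omega> \<bullet> rv_sub S X \<omega> = sq_norm_fun (card S) (\<lambda>a. X (sorted_list_of_set S ! a) \<omega>)"
    unfolding sq_norm_fun_eq_scalar_prod rv_sub_def sub_vec_def ..
  thus ?thesis unfolding vnorm_def by simp
qed

text \<open>One exponential moment of the squared Euclidean norm gives a common scale
  \<open>c\<close> for all coordinates. The condition depends only on the law of the regressors on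
  \<open>S\<close>, so the same \<open>c\<close> serves every realisation.\<close>

locale subgaussian_vector = prob_space P for P :: "'w measure" +
  fixes S :: "nat set" and X :: "nat \<Rightarrow> 'w \<Rightarrow> real" and c :: real
  assumes finite_S: "finite S"
    and X_meas: "\<And>i. i \<in> S \<Longrightarrow> X i \<in> borel_measurable P"
    and c_pos: "c > 0"
    and exp_moment: "(\<integral>\<^sup>+\<omega>. ennreal (exp (sq_norm_fun (card S) (\<lambda>a. X (sorted_list_of_set S ! a) \<omega>) / c\<^sup>2)) \<partial>P) \<le> 2"
begin

abbreviation "Y a \<equiv> X (sorted_list_of_set S ! a)"

lemma Y_meas [measurable]: "a < card S \<Longrightarrow> Y a \<in> borel_measurable P"
  by (intro X_meas sorted_list_of_set_nth_in finite_S)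

lemma coord_subgaussian:
  assumes "a < card S"
  shows "(\<integral>\<^sup>+\<omega>. ennreal (exp ((Y a \<omega>)\<^sup>2 / c\<^sup>2)) \<partial>P) \<le> 2"
proof -
  have "(Y a \<omega>)\<^sup>2 \<le> sq_norm_fun (card S) (\<lambda>a. Y a \<omega>)" for \<omega>
    unfolding sq_norm_fun_def using assms by (intro member_le_sum) auto
  hence "(\<integral>\<^sup>+\<omega>. ennreal (exp ((Y a \<omega>)\<^sup>2 / c\<^sup>2)) \<partial>P)
      \<le> (\<integral>\<^sup>+\<omega>. ennreal (exp (sq_norm_fun (card S) (\<lambda>a. Y a \<omega>) / c\<^sup>2)) \<partial>P)"
    by (intro nn_integral_mono ennreal_leI) (simp add: divide_right_mono)
  thus ?thesis using exp_moment by simp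
qed

lemma pair_subexp:
  assumes "a < card S" "b < card S"
  shows "(\<integral>\<^sup>+\<omega>. ennreal (exp (\<bar>Y a \<omega> * Y b \<omega>\<bar> / c\<^sup>2)) \<partial>P) \<le> 2"
  unfolding power2_eq_square using assms
  by (intro subgaussian_mult_subexp c_pos coord_subgaussian) auto

lemma coord_subexp:
  assumes "a < card S"
  shows "(\<integral>\<^sup>+\<omega>. ennreal (exp (\<bar>Y a \<omega>\<bar> / (2 * c))) \<partial>P) \<le> 2"
  using assms by (intro subexp_of_subgaussian c_pos coord_subgaussian) auto

lemma pair_integrable:
  assumes "a < card S" "b < card S"
  shows "integrable P (\<lambda>\<omega>. Y a \<omega> * Y b \<omega>)" "\<bar>expectation (\<lambda>\<omega>. Y a \<omega> * Y b \<omega>)\<bar> \<le> 2 * c\<^sup>2"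
  using subexp_integrable[OF _ _ pair_subexp[OF assms]] assms c_pos by auto

lemma coord_integrable:
  assumes "a < card S"
  shows "integrable P (Y a)" "\<bar>expectation (Y a)\<bar> \<le> 4 * c"
  using subexp_integrable[OF _ _ coord_subexp[OF assms]] assms c_pos by auto

lemma cov_mat_entry:
  assumes "a < card S" "b < card S"
  shows "cov_mat P S X $$ (a, b) = expectation (\<lambda>\<omega>. Y a \<omega> * Y b \<omega>) - expectation (Y a) * expectation (Y b)"
proof -
  have "cov_mat P S X $$ (a, b) = expectation (\<lambda>\<omega>. (Y a \<omega> - expectation (Y a)) * (Y b \<omega> - expectation (Y b)))"
    using assms by (simp add: cov_mat_def mean_vec_def rv_sub_def sub_vec_def)
  also have "\<dots> = expectation (\<lambda>\<omega>. Y a \<omega> * Y b \<omega> - Y a \<omega> * expectation (Y b) - expectation (Y a) * Y b \<omega>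
      + expectation (Y a) * expectation (Y b))"
    by (simp add: algebra_simps)
  also have "\<dots> = expectation (\<lambda>\<omega>. Y a \<omega> * Y b \<omega>) - expectation (Y a) * expectation (Y b)"
    using assms by (simp add: pair_integrable coord_integrable prob_space)
  finally show ?thesis .
qed

text \<open>The form at \<open>v\<close> is the variance of the linear combination of the
  coordinates with coefficients \<open>v\<close>.\<close>

lemma cov_mat_psd: "bilin (card S) (\<lambda>a b. cov_mat P S X $$ (a, b)) v v \<ge> 0"
proof -
  let ?s = "card S"
  have int: "integrable P (\<lambda>\<omega>. (Y a \<omega> - expectation (Y a)) * (Y b \<omega> - expectation (Y b)))"
    if "a < ?s" "b < ?s" for a b
  proof -
    have "integrable P (\<lambda>\<omega>. Y a \<omega> * Y b \<omega> - Y a \<omega> * expectation (Y b) - expectation (Y a) * Y b \<omega>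
      + expectation (Y a) * expectation (Y b))"
      using that by (simp add: pair_integrable coord_integrable)
    thus ?thesis by (simp add: algebra_simps)
  qed
  have "bilin ?s (\<lambda>a b. cov_mat P S X $$ (a, b)) v v
      = (\<Sum>a<?s. \<Sum>b<?s. expectation (\<lambda>\<omega>. (Y a \<omega> - expectation (Y a)) * (Y b \<omega> - expectation (Y b)) * (v a * v b)))"
    unfolding bilin_def
    by (intro sum.cong refl) (simp add: cov_mat_def mean_vec_def rv_sub_def sub_vec_def mult_ac)
  also have "\<dots> = expectation (\<lambda>\<omega>. \<Sum>a<?s. \<Sum>b<?s. (Y a \<omega> - expectation (Y a)) * (Y b \<omega> - expectation (Y b)) * (v a * v b))"
  proof -
    have i: "integrable P (\<lambda>\<omega>. (Y a \<omega> - expectation (Y a)) * (Y b \<omega> - expectation (Y b)) * (v a * v b))"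
      if "a < ?s" "b < ?s" for a b using int[OF that] by simp
    have "(\<Sum>a<?s. \<Sum>b<?s. expectation (\<lambda>\<omega>. (Y a \<omega> - expectation (Y a)) * (Y b \<omega> - expectation (Y b)) * (v a * v b)))
       = (\<Sum>a<?s. expectation (\<lambda>\<omega>. \<Sum>b<?s. (Y a \<omega> - expectation (Y a)) * (Y b \<omega> - expectation (Y b)) * (v a * v b)))"
      using i by (intro sum.cong refl Bochner_Integration.integral_sum[symmetric]) blast
    also have "\<dots> = expectation (\<lambda>\<omega>. \<Sum>a<?s. \<Sum>b<?s. (Y a \<omega> - expectation (Y a)) * (Y b \<omega> - expectation (Y b)) * (v a * v b))"
      using i by (intro Bochner_Integration.integral_sum[symmetric] Bochner_Integration.integrable_sum) blast
    finally show ?thesis .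
  qed
  also have "\<dots> = expectation (\<lambda>\<omega>. (\<Sum>a<?s. (Y a \<omega> - expectation (Y a)) * v a)\<^sup>2)"
    by (simp add: power2_eq_square sum_product mult_ac)
  also have "\<dots> \<ge> 0" by (rule Bochner_Integration.integral_nonneg) simp
  finally show ?thesis .
qed

lemma cov_mat_sym: "a < card S \<Longrightarrow> b < card S \<Longrightarrow> cov_mat P S X $$ (a, b) = cov_mat P S X $$ (b, a)"
  by (simp add: cov_mat_entry mult.commute)

end

section \<open>Transfer between realisations of the same law, and the scale from the Orlicz
  norm\<close>

lemma measurable_coords:
  assumes "\<And>i. i \<in> I \<Longrightarrow> X i \<in> borel_measurable P"
  shows "coords I X \<in> measurable P (coord_space I)"
  unfolding coords_def[abs_def] coord_space_def using assms by (intro measurable_restrict) auto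

lemma measurable_coord_space_component:
  "i \<in> I \<Longrightarrow> (\<lambda>x. x i) \<in> borel_measurable (coord_space I)"
  unfolding coord_space_def by (rule measurable_component_singleton)

lemma coords_apply: "i \<in> I \<Longrightarrow> coords I X \<omega> i = X i \<omega>"
  by (simp add: coords_def)

lemma nn_integral_law_cong:
  assumes law: "law P S X = law P' S X'"
    and X: "\<And>i. i \<in> S \<Longrightarrow> X i \<in> borel_measurable P" and X': "\<And>i. i \<in> S \<Longrightarrow> X' i \<in> borel_measurable P'"
    and f: "f \<in> borel_measurable (coord_space S)"
  shows "(\<integral>\<^sup>+\<omega>. f (coords S X \<omega>) \<partial>P) = (\<integral>\<^sup>+\<omega>. f (coords S X' \<omega>) \<partial>P')"
proof -
  have "(\<integral>\<^sup>+\<omega>. f (coords S X \<omega>) \<partial>P) = (\<integral>\<^sup>+x. f x \<partial>law P S X)"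
    unfolding law_def using X f by (intro nn_integral_distr[symmetric] measurable_coords) auto
  also have "\<dots> = (\<integral>\<^sup>+\<omega>. f (coords S X' \<omega>) \<partial>P')"
    unfolding law unfolding law_def using X' f by (intro nn_integral_distr measurable_coords) auto
  finally show ?thesis .
qed

lemma integral_law_cong:
  fixes f :: "(nat \<Rightarrow> real) \<Rightarrow> real"
  assumes law: "law P S X = law P' S X'"
    and X: "\<And>i. i \<in> S \<Longrightarrow> X i \<in> borel_measurable P" and X': "\<And>i. i \<in> S \<Longrightarrow> X' i \<in> borel_measurable P'"
    and f: "f \<in> borel_measurable (coord_space S)"
  shows "(\<integral>\<omega>. f (coords S X \<omega>) \<partial>P) = (\<integral>\<omega>. f (coords S X' \<omega>) \<partial>P')"
proof -
  have "(\<integral>\<omega>. f (coords S X \<omega>) \<partial>P) = (\<integral>x. f x \<partial>law P S X)"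
    unfolding law_def using X f by (intro integral_distr[symmetric] measurable_coords) auto
  also have "\<dots> = (\<integral>\<omega>. f (coords S X' \<omega>) \<partial>P')"
    unfolding law unfolding law_def using X' f by (intro integral_distr measurable_coords) auto
  finally show ?thesis .
qed

text \<open>Allows \<open>c\<close> and \<open>lam\<close>, hence the final constant, to be fixed on
  one realisation before any other is given.\<close>

lemma subgaussian_vector_law_cong:
  assumes P: "subgaussian_vector P S X c" and "prob_space P'" and law: "law P S X = law P' S X'"
    and X': "\<And>i. i \<in> S \<Longrightarrow> X' i \<in> borel_measurable P'"
  shows "subgaussian_vector P' S X' c" "cov_mat P' S X' = cov_mat P S X"
proof -
  interpret P: subgaussian_vector P S X c by fact
  interpret P': prob_space P' by fact
  note nth_in = sorted_list_of_set_nth_in[OF P.finite_S]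
  have meas_sq [measurable]: "(\<lambda>x. sq_norm_fun (card S) (\<lambda>a. x (sorted_list_of_set S ! a))) \<in> borel_measurable (coord_space S)"
    unfolding sq_norm_fun_def
    by (intro borel_measurable_sum borel_measurable_power measurable_coord_space_component nth_in) auto
  have meas_exp: "(\<lambda>x. ennreal (exp (sq_norm_fun (card S) (\<lambda>a. x (sorted_list_of_set S ! a)) / c\<^sup>2))) \<in> borel_measurable (coord_space S)"
    by measurable
  have e: "(\<integral>\<^sup>+\<omega>. ennreal (exp (sq_norm_fun (card S) (\<lambda>a. coords S X \<omega> (sorted_list_of_set S ! a)) / c\<^sup>2)) \<partial>P)
     = (\<integral>\<^sup>+\<omega>. ennreal (exp (sq_norm_fun (card S) (\<lambda>a. coords S X' \<omega> (sorted_list_of_set S ! a)) / c\<^sup>2)) \<partial>P')"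
    by (rule nn_integral_law_cong[OF law P.X_meas X']) (auto intro: meas_exp)
  show P'sub: "subgaussian_vector P' S X' c"
  proof
    show "(\<integral>\<^sup>+\<omega>. ennreal (exp (sq_norm_fun (card S) (\<lambda>a. X' (sorted_list_of_set S ! a) \<omega>) / c\<^sup>2)) \<partial>P') \<le> 2"
      using e P.exp_moment by (simp add: sq_norm_fun_def coords_apply nth_in)
  qed (use P.finite_S P.c_pos X' in auto)
  interpret P': subgaussian_vector P' S X' c by fact
  have m: "P'.expectation (P'.Y a) = P.expectation (P.Y a)" if "a < card S" for a
    using integral_law_cong[OF law P.X_meas X', of "\<lambda>x. x (sorted_list_of_set S ! a)"] that
    by (simp add: coords_apply nth_in measurable_coord_space_component)
  have l: "P'.expectation (\<lambda>\<omega>. P'.Y a \<omega> * P'.Y b \<omega>) = P.expectation (\<lambda>\<omega>. P.Y a \<omega> * P.Y b \<omega>)"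
    if "a < card S" "b < card S" for a b
    using integral_law_cong[OF law P.X_meas X', of "\<lambda>x. x (sorted_list_of_set S ! a) * x (sorted_list_of_set S ! b)"] that
    by (simp add: coords_apply nth_in borel_measurable_times measurable_coord_space_component)
  have dims: "cov_mat P S X \<in> carrier_mat (card S) (card S)" "cov_mat P' S X' \<in> carrier_mat (card S) (card S)"
    by (auto simp: cov_mat_def)
  show "cov_mat P' S X' = cov_mat P S X"
    by (rule eq_matI) (use dims in \<open>auto simp: P.cov_mat_entry P'.cov_mat_entry m l\<close>)
qed

lemma psi_norm_2_finiteE:
  assumes "psi_norm P 2 W < \<infinity>"
  obtains C where "C > 0" "(\<integral>\<^sup>+\<omega>. ennreal (exp ((W \<omega>)\<^sup>2 / C\<^sup>2)) \<partial>P) \<le> 2"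
proof -
  obtain C where C: "C > 0" "(\<integral>\<^sup>+\<omega>. ennreal (exp (\<bar>W \<omega>\<bar> powr 2 / C powr 2)) \<partial>P) \<le> 2"
    using assms unfolding psi_norm_def Inf_less_iff by auto
  have "\<bar>w\<bar> powr 2 = w\<^sup>2" for w :: real by (cases "w = 0") auto
  thus thesis using C by (intro that[of C]) auto
qed

text \<open>Finiteness of the Orlicz part of the maximum provides an admissible constant, which
  becomes the scale.\<close>

lemma subgaussian_vector_if_moment_bound:
  assumes "prob_space P" "finite S" "\<And>i. i \<in> S \<Longrightarrow> X i \<in> borel_measurable P"
    and "moment_bound P S X \<le> ennreal K"
  shows "\<exists>c. subgaussian_vector P S X c"
proof -
  have "psi_norm P 2 (\<lambda>\<omega>. vnorm (rv_sub S X \<omega>)) \<le> ennreal K"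
    using assms(4) by (simp add: moment_bound_def)
  also have "\<dots> < \<infinity>" by simp
  finally obtain C where "C > 0" "(\<integral>\<^sup>+\<omega>. ennreal (exp ((vnorm (rv_sub S X \<omega>))\<^sup>2 / C\<^sup>2)) \<partial>P) \<le> 2"
    by (rule psi_norm_2_finiteE)
  thus ?thesis using assms(1-3)
    by (intro exI[of _ C]) (simp add: subgaussian_vector_def subgaussian_vector_axioms_def sq_vnorm_rv_sub)
qed

section \<open>Simultaneous deviation bounds for regressors and noise\<close>

context prob_space
begin

text \<open>Union bound: at most \<open>t / 2\<close> statistics, each failing with probability at
  most \<open>2 / t ^ 3\<close>. Every statistic has its own scale, since the noise level differs
  between rows.\<close>

lemma iid_concentration_family:
  fixes h :: "'i \<Rightarrow> 'b \<Rightarrow> real" and t :: nat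
  assumes ind: "indep_vars (\<lambda>_. N) Z {..<t}"
    and id: "\<And>l. l < t \<Longrightarrow> distr M N (Z l) = distr M N Z0"
    and Z0 [measurable]: "Z0 \<in> measurable M N"
    and J: "finite J" "2 * card J \<le> t"
    and h [measurable]: "\<And>j. j \<in> J \<Longrightarrow> h j \<in> borel_measurable N" and c: "\<And>j. j \<in> J \<Longrightarrow> c j > 0"
    and hc: "\<And>j. j \<in> J \<Longrightarrow> (\<integral>\<^sup>+x. ennreal (exp (\<bar>h j (Z0 x)\<bar> / c j)) \<partial>M) \<le> 2"
    and t: "t > 1" and \<rho>: "sqrt (ln t / t) \<le> 1 / 2"
  shows "prob {x\<in>space M. \<forall>j\<in>J. \<bar>(\<Sum>l<t. h j (Z l x)) / t - expectation (\<lambda>x. h j (Z0 x))\<bar> \<le> 11 * c j * sqrt (ln t / t)}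
    \<ge> 1 - 1 / (real t)\<^sup>2"
proof -
  let ?D = "\<lambda>j x. \<bar>(\<Sum>l<t. h j (Z l x)) / t - expectation (\<lambda>x. h j (Z0 x))\<bar>"
  let ?r = "sqrt (ln t / t)"
  let ?G = "{x\<in>space M. \<forall>j\<in>J. ?D j x \<le> 11 * c j * ?r}"
  let ?B = "\<lambda>j. {x\<in>space M. ?D j x \<ge> 11 * c j * ?r}"
  have Z: "Z l \<in> measurable M N" if "l < t" for l
    using ind that by (auto simp: indep_vars_def)
  have [measurable]: "(\<lambda>x. \<Sum>l<t. h j (Z l x)) \<in> borel_measurable M" if "j \<in> J" for j
    using that by (intro borel_measurable_sum measurable_compose[OF Z h]) auto
  have Bm: "?B j \<in> events" if "j \<in> J" for j using that by measurable
  have Gm: "?G \<in> events"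
    using J(1) by (intro sets.sets_Collect_finite_All) measurable
  have "1 - prob ?G = prob (space M - ?G)" using Gm by (simp add: prob_compl)
  also have "\<dots> \<le> prob (\<Union>j\<in>J. ?B j)"
  proof (intro finite_measure_mono subsetI)
    fix x assume "x \<in> space M - ?G"
    then obtain j where "x \<in> space M" "j \<in> J" "\<not> ?D j x \<le> 11 * c j * ?r" by blast
    moreover from this(3) have "?D j x \<ge> 11 * c j * ?r" by linarith
    ultimately show "x \<in> (\<Union>j\<in>J. ?B j)" by blast
  qed (use Bm J(1) in auto)
  also have "\<dots> \<le> (\<Sum>j\<in>J. prob (?B j))"
    using Bm J(1) by (intro finite_measure_subadditive_finite) auto
  also have "\<dots> \<le> (\<Sum>j\<in>J. 2 / real t ^ 3)"
    using h c hc by (intro sum_mono iid_subexp_concentration[OF ind id Z0] t \<rho>) auto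
  also have "\<dots> = real (2 * card J) / real t ^ 3" by simp
  also have "\<dots> \<le> real t / real t ^ 3" using J(2) by (intro divide_right_mono) auto
  also have "\<dots> = 1 / (real t)\<^sup>2" using t by (simp add: power2_eq_square power3_eq_cube)
  finally show ?thesis by simp
qed

end

context subgaussian_vector
begin

text \<open>The residual \<open>r\<close> agrees almost surely with \<open>(Q \<epsilon>)_i\<close>,
  a scalar centred Gaussian independent of the regressors. The first fact gives the scale of the
  product, independence its mean. The scale \<sigma> may exceed the standard deviation, which can be
  zero.\<close>

lemma noise_subexp_centred:
  fixes q k :: nat
  assumes lm: "linear_model P S X k F \<beta> \<Gamma> \<epsilon>" and F: "\<And>j. j < k \<Longrightarrow> F j \<in> borel_measurable P"
    and Q: "Q \<in> carrier_mat q k" and i: "i < q" and a: "a < card S"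
    and \<sigma>: "\<sigma> > 0" "row Q i \<bullet> (\<Gamma> *\<^sub>v row Q i) \<le> \<sigma>\<^sup>2"
  defines "r \<equiv> (\<lambda>\<omega>. \<Sum>j<k. Q $$ (i, j) * (F j \<omega> - (\<Sum>b<card S. \<beta> $$ (j, b) * Y b \<omega>)))"
  shows "(\<integral>\<^sup>+\<omega>. ennreal (exp (\<bar>r \<omega> * Y a \<omega>\<bar> / (2 * \<sigma> * c))) \<partial>P) \<le> 2"
    and "expectation (\<lambda>\<omega>. r \<omega> * Y a \<omega>) = 0"
proof -
  let ?\<theta> = "row Q i"
  define v where "v = ?\<theta> \<bullet> (\<Gamma> *\<^sub>v ?\<theta>)"
  define g where "g = (\<lambda>\<omega>. \<Sum>j<k. Q $$ (i, j) * \<epsilon> j \<omega>)"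
  have \<beta>: "\<beta> \<in> carrier_mat k (card S)" and cg: "centred_gaussian P k \<epsilon> \<Gamma>"
    and model: "AE \<omega> in P. vec k (\<lambda>j. F j \<omega>) = \<beta> *\<^sub>v rv_sub S X \<omega> + vec k (\<lambda>j. \<epsilon> j \<omega>)"
    and ind: "indep_var (coord_space S) (coords S X) (coord_space {..<k}) (coords {..<k} \<epsilon>)"
    using lm by (auto simp: linear_model_def)
  have \<theta>: "?\<theta> \<in> carrier_vec k" using Q i by auto
  have g_eq: "?\<theta> \<bullet> vec k (\<lambda>j. \<epsilon> j \<omega>) = g \<omega>" for \<omega>
    using Q i by (simp add: scalar_prod_def g_def atLeast0LessThan)
  have \<epsilon>: "\<And>j. j < k \<Longrightarrow> \<epsilon> j \<in> borel_measurable P" and v0: "v \<ge> 0"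
    and "distr P borel (\<lambda>\<omega>. ?\<theta> \<bullet> vec k (\<lambda>j. \<epsilon> j \<omega>)) = normal_law 0 v"
    using cg \<theta> unfolding centred_gaussian_def v_def by blast+
  hence dist: "distr P borel g = normal_law 0 v" unfolding g_eq by simp
  have [measurable]: "g \<in> borel_measurable P"
    unfolding g_def using \<epsilon> by (intro borel_measurable_sum borel_measurable_times) auto
  have [measurable]: "r \<in> borel_measurable P"
    unfolding r_def using F by (intro borel_measurable_sum borel_measurable_times borel_measurable_diff) auto
  have Ya [measurable]: "Y a \<in> borel_measurable P" using a by simp
  have rg: "AE \<omega> in P. r \<omega> = g \<omega>"
    using model
  proof eventually_elim
    case (elim \<omega>)
    have "F j \<omega> = (\<Sum>b<card S. \<beta> $$ (j, b) * Y b \<omega>) + \<epsilon> j \<omega>" if "j < k" for j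
    proof -
      have "(vec k (\<lambda>j. F j \<omega>)) $ j = (\<beta> *\<^sub>v rv_sub S X \<omega> + vec k (\<lambda>j. \<epsilon> j \<omega>)) $ j"
        by (simp only: elim)
      thus ?thesis using that \<beta>
        by (simp add: rv_sub_def sub_vec_def scalar_prod_def atLeast0LessThan)
    qed
    thus ?case by (simp add: r_def g_def)
  qed
  \<comment> \<open>A normal variable has sub-Gaussian scale twice its standard deviation, whence
    \<open>2 * \<sigma>\<close>.\<close>
  have "sqrt v \<le> \<sigma>" using \<sigma> by (simp add: v_def real_le_lsqrt)
  hence "(\<integral>\<^sup>+x. ennreal (exp (x\<^sup>2 / (2 * \<sigma>)\<^sup>2)) \<partial>normal_law 0 v) \<le> 2"
    using v0 \<sigma> by (intro nn_integral_exp_square_normal_law) auto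
  hence gs: "(\<integral>\<^sup>+\<omega>. ennreal (exp ((g \<omega>)\<^sup>2 / (2 * \<sigma>)\<^sup>2)) \<partial>P) \<le> 2"
    unfolding dist[symmetric] by (simp add: nn_integral_distr)
  also have "(\<integral>\<^sup>+\<omega>. ennreal (exp ((g \<omega>)\<^sup>2 / (2 * \<sigma>)\<^sup>2)) \<partial>P) = (\<integral>\<^sup>+\<omega>. ennreal (exp ((r \<omega>)\<^sup>2 / (2 * \<sigma>)\<^sup>2)) \<partial>P)"
    by (rule nn_integral_cong_AE, use rg in eventually_elim) simp
  finally show "(\<integral>\<^sup>+\<omega>. ennreal (exp (\<bar>r \<omega> * Y a \<omega>\<bar> / (2 * \<sigma> * c))) \<partial>P) \<le> 2"
    using \<sigma> c_pos coord_subgaussian[OF a] by (intro subgaussian_mult_subexp) auto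
  have g_int: "integrable P g"
    using subexp_integrable(1)[OF _ _ subexp_of_subgaussian[OF _ _ gs]] \<sigma> by auto
  have "expectation g = (\<integral>x. x \<partial>distr P borel g)" by (simp add: integral_distr)
  also have "\<dots> = 0" unfolding dist using v0 by (rule integral_normal_law)
  finally have g0: "expectation g = 0" .
  have "indep_var borel ((\<lambda>x. x (sorted_list_of_set S ! a)) \<circ> coords S X)
      borel ((\<lambda>e. \<Sum>j<k. Q $$ (i, j) * e j) \<circ> coords {..<k} \<epsilon>)"
    using a by (intro indep_var_compose[OF ind] borel_measurable_sum borel_measurable_times
        measurable_coord_space_component sorted_list_of_set_nth_in finite_S) auto
  moreover have "(\<lambda>x. x (sorted_list_of_set S ! a)) \<circ> coords S X = Y a"
    using a by (auto simp: coords_apply sorted_list_of_set_nth_in finite_S)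
  moreover have "(\<lambda>e. \<Sum>j<k. Q $$ (i, j) * e j) \<circ> coords {..<k} \<epsilon> = g"
    by (auto simp: g_def coords_apply)
  ultimately have "indep_var borel (Y a) borel g" by simp
  hence "expectation (\<lambda>\<omega>. Y a \<omega> * g \<omega>) = expectation (Y a) * expectation g"
    using coord_integrable(1)[OF a] g_int by (rule indep_var_lebesgue_integral)
  moreover have "expectation (\<lambda>\<omega>. r \<omega> * Y a \<omega>) = expectation (\<lambda>\<omega>. Y a \<omega> * g \<omega>)"
  proof (rule integral_cong_AE)
    show "AE \<omega> in P. r \<omega> * Y a \<omega> = Y a \<omega> * g \<omega>" using rg by eventually_elim simp
  qed measurable
  ultimately show "expectation (\<lambda>\<omega>. r \<omega> * Y a \<omega>) = 0" by (simp add: g0)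
qed

text \<open>Second moments, means and noise products are treated as one finite family of statistics
  of the joint observation, so a single event carries all bounds that the deterministic estimate
  requires.\<close>

lemma trace_form_concentration:
  fixes q k t n :: nat and lam D :: real
  assumes S: "S \<subseteq> {1..n}" and X: "\<And>i. i \<in> {1..n} \<Longrightarrow> X i \<in> borel_measurable P"
    and F: "\<And>j. j < k \<Longrightarrow> F j \<in> borel_measurable P"
    and lm: "linear_model P S X k F \<beta> \<Gamma> \<epsilon>" and Q: "Q \<in> carrier_mat q k"
    and lam: "lam > 0"
    and pos: "\<And>v. bilin (card S) (\<lambda>a b. cov_mat P S X $$ (a, b)) v v \<ge> lam * sq_norm_fun (card S) v"
    and SB: "(\<Sum>i<q. sq_norm_fun (card S) (\<lambda>a. (Q * \<beta>) $$ (i, a))) > 0"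
    and D: "D \<ge> 0" "(\<Sum>i<q. row Q i \<bullet> (\<Gamma> *\<^sub>v row Q i)) \<le> D * (\<Sum>i<q. sq_norm_fun (card S) (\<lambda>a. (Q * \<beta>) $$ (i, a)))"
    and iid: "iid_samples P n X k F t Xs Fs"
    and t: "t > 1" "2 * (card S * card S + (card S + q * card S)) \<le> t"
    and \<rho>: "sqrt (ln t / t) \<le> 1 / 2" "1 / (real t - 1) \<le> sqrt (ln t / t)"
      "11 * c\<^sup>2 * sqrt (ln t / t) * card S \<le> lam / 2"
    and C: "error_const (card S) c lam (D + 1) \<le> C"
  shows "prob {\<omega> \<in> space P. \<bar>trace_form (Sigma_hat S t (\<lambda>l i. Xs l i \<omega>))
              (beta_hat S k t (\<lambda>l i. Xs l i \<omega>) (\<lambda>l j. Fs l j \<omega>)) Q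
            - trace_form (cov_mat P S X) \<beta> Q\<bar> / trace_form (cov_mat P S X) \<beta> Q
          \<le> C * sqrt (ln t / t)} \<ge> 1 - 1 / (real t)\<^sup>2"
    (is "prob ?E \<ge> _")
proof -
  let ?s = "card S" and ?r = "sqrt (ln t / t)"
  let ?SB = "\<Sum>i<q. sq_norm_fun ?s (\<lambda>a. (Q * \<beta>) $$ (i, a))"
  let ?N = "coord_space {1..n} \<Otimes>\<^sub>M coord_space {..<k}"
  define \<iota> where "\<iota> = (\<lambda>a. sorted_list_of_set S ! a)"
  \<comment> \<open>The share \<open>?SB / q\<close> keeps the scale positive when row \<open>i\<close> carries no noise; the squared scales
    still sum to at most \<open>(D + 1) * ?SB\<close>, so that the constant does not depend on \<open>q\<close>.\<close>
  define \<sigma> where "\<sigma> = (\<lambda>i. sqrt (row Q i \<bullet> (\<Gamma> *\<^sub>v row Q i) + ?SB / q))"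
  define Z where "Z = (\<lambda>l \<omega>. (coords {1..n} (Xs l) \<omega>, coords {..<k} (Fs l) \<omega>))"
  define Z0 where "Z0 = (\<lambda>\<omega>. (coords {1..n} X \<omega>, coords {..<k} F \<omega>))"
  define h1 where "h1 = (\<lambda>(a, b) (z :: (nat \<Rightarrow> real) \<times> (nat \<Rightarrow> real)). fst z (\<iota> a) * fst z (\<iota> b) :: real)"
  define h2 where "h2 = (\<lambda>a (z :: (nat \<Rightarrow> real) \<times> (nat \<Rightarrow> real)). fst z (\<iota> a) :: real)"
  \<comment> \<open>The noise enters as a residual, because only the joint law of regressors and
    response is shared by the samples.\<close>
  define h3 where "h3 = (\<lambda>(i, a) z. (\<Sum>j<k. Q $$ (i, j) * (snd z j - (\<Sum>b<?s. \<beta> $$ (j, b) * fst z (\<iota> b)))) * fst z (\<iota> a) :: real)"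
  define h where "h = case_sum h1 (case_sum h2 h3)"
  \<comment> \<open>The scales of products, single coordinates and noise products; times 11 they
    give the deviations \<open>11 * c\<^sup>2\<close>, \<open>22 * c\<close> and
    \<open>22 * c * \<sigma> i\<close> of the deterministic estimate.\<close>
  define cc where "cc = case_sum (\<lambda>_ :: nat \<times> nat. c\<^sup>2) (case_sum (\<lambda>_ :: nat. 2 * c) (\<lambda>(i, _ :: nat). 2 * \<sigma> i * c))"
  define J where "J = ({..<?s} \<times> {..<?s}) <+> ({..<?s} <+> ({..<q} \<times> {..<?s}))"
  have \<beta>: "\<beta> \<in> carrier_mat k ?s" using lm by (simp add: linear_model_def)
  have \<iota>S: "\<iota> a \<in> S" if "a < ?s" for a unfolding \<iota>_def using finite_S that by (rule sorted_list_of_set_nth_in)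
  hence \<iota>n: "\<iota> a \<in> {1..n}" if "a < ?s" for a using that S by blast
  have q: "q > 0" using SB by (cases q) auto
  have \<gamma>: "row Q i \<bullet> (\<Gamma> *\<^sub>v row Q i) \<ge> 0" if "i < q" for i
  proof -
    have "row Q i \<in> carrier_vec k" using Q that by auto
    thus ?thesis using lm unfolding linear_model_def centred_gaussian_def by blast
  qed
  have \<sigma>2: "(\<sigma> i)\<^sup>2 = row Q i \<bullet> (\<Gamma> *\<^sub>v row Q i) + ?SB / q" and \<sigma>0: "\<sigma> i > 0" if "i < q" for i
  proof -
    have "row Q i \<bullet> (\<Gamma> *\<^sub>v row Q i) + ?SB / q > 0"
      using \<gamma>[OF that] divide_pos_pos[OF SB, of "real q"] q by linarith
    thus "(\<sigma> i)\<^sup>2 = row Q i \<bullet> (\<Gamma> *\<^sub>v row Q i) + ?SB / q" "\<sigma> i > 0" by (auto simp: \<sigma>_def)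
  qed
  have \<sigma>_sum: "(\<Sum>i<q. (\<sigma> i)\<^sup>2) \<le> (D + 1) * ?SB"
  proof -
    have "(\<Sum>i<q. (\<sigma> i)\<^sup>2) = (\<Sum>i<q. row Q i \<bullet> (\<Gamma> *\<^sub>v row Q i)) + (\<Sum>i<q. ?SB / q)"
      unfolding sum.distrib[symmetric] by (intro sum.cong refl) (simp add: \<sigma>2)
    also have "(\<Sum>i<q. ?SB / q) = ?SB" using q by simp
    finally show ?thesis using D(2) by (simp add: distrib_right)
  qed
  have ind: "indep_vars (\<lambda>_. ?N) Z {..<t}" and id: "\<And>l. l < t \<Longrightarrow> distr P ?N (Z l) = distr P ?N Z0"
    using iid by (auto simp: iid_samples_def Z_def Z0_def)
  have Z0m: "Z0 \<in> measurable P ?N"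
    unfolding Z0_def using X F by (intro measurable_Pair measurable_coords) auto
  have fst_m: "(\<lambda>z. fst z i) \<in> borel_measurable ?N" if "i \<in> {1..n}" for i
    using that by (intro measurable_compose[OF measurable_fst measurable_coord_space_component])
  have snd_m: "(\<lambda>z. snd z j) \<in> borel_measurable ?N" if "j < k" for j
    using that by (intro measurable_compose[OF measurable_snd measurable_coord_space_component]) auto
  have Zm: "Z l \<in> measurable P ?N" if "l < t" for l using ind that by (auto simp: indep_vars_def)
  have Xs: "Xs l i \<in> borel_measurable P" if "l < t" "i \<in> S" for l i
  proof -
    have i: "i \<in> {1..n}" using that S by blast
    have "(\<lambda>\<omega>. fst (Z l \<omega>) i) \<in> borel_measurable P"
      by (rule measurable_compose[OF Zm[OF that(1)] fst_m[OF i]])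
    thus ?thesis using i by (simp add: Z_def coords_apply del: atLeastAtMost_iff)
  qed
  have Fs: "Fs l j \<in> borel_measurable P" if "l < t" "j < k" for l j
  proof -
    have "(\<lambda>\<omega>. snd (Z l \<omega>) j) \<in> borel_measurable P"
      by (rule measurable_compose[OF Zm[OF that(1)] snd_m[OF that(2)]])
    thus ?thesis using that by (simp add: Z_def coords_apply)
  qed
  have Jf: "finite J" by (simp add: J_def)
  have Jc: "card J = ?s * ?s + (?s + q * ?s)" by (simp add: J_def card_Plus)
  have h1_Z0: "h1 (a, b) (Z0 \<omega>) = Y a \<omega> * Y b \<omega>" if "a < ?s" "b < ?s" for a b \<omega>
    using that \<iota>n by (simp add: h1_def Z0_def coords_apply \<iota>_def del: atLeastAtMost_iff)
  have h2_Z0: "h2 a (Z0 \<omega>) = Y a \<omega>" if "a < ?s" for a \<omega>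
    using that \<iota>n by (simp add: h2_def Z0_def coords_apply \<iota>_def del: atLeastAtMost_iff)
  have h3_Z0: "h3 (i, a) (Z0 \<omega>) = (\<Sum>j<k. Q $$ (i, j) * (F j \<omega> - (\<Sum>b<?s. \<beta> $$ (j, b) * Y b \<omega>))) * Y a \<omega>"
    if "a < ?s" for i a \<omega>
    using that \<iota>n by (simp add: h3_def Z0_def coords_apply \<iota>_def del: atLeastAtMost_iff)
  have h1_Z: "h1 (a, b) (Z l \<omega>) = Xs l (sorted_list_of_set S ! a) \<omega> * Xs l (sorted_list_of_set S ! b) \<omega>"
    if "a < ?s" "b < ?s" for a b l \<omega>
    using that \<iota>n by (simp add: h1_def Z_def coords_apply \<iota>_def del: atLeastAtMost_iff)
  have h2_Z: "h2 a (Z l \<omega>) = Xs l (sorted_list_of_set S ! a) \<omega>" if "a < ?s" for a l \<omega>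
    using that \<iota>n by (simp add: h2_def Z_def coords_apply \<iota>_def del: atLeastAtMost_iff)
  have hm: "h j \<in> borel_measurable ?N" if "j \<in> J" for j
    using that \<iota>n unfolding J_def h_def h1_def h2_def h3_def
    by (auto simp del: atLeastAtMost_iff One_nat_def intro!: borel_measurable_sum borel_measurable_times borel_measurable_diff
        fst_m snd_m)
  have ccp: "cc j > 0" if "j \<in> J" for j
    using that c_pos \<sigma>0 by (auto simp: J_def cc_def)
  have hc: "(\<integral>\<^sup>+\<omega>. ennreal (exp (\<bar>h j (Z0 \<omega>)\<bar> / cc j)) \<partial>P) \<le> 2" if j: "j \<in> J" for j
  proof -
    consider a b where "j = Inl (a, b)" "a < ?s" "b < ?s" | a where "j = Inr (Inl a)" "a < ?s"
      | i a where "j = Inr (Inr (i, a))" "i < q" "a < ?s" using j by (auto simp: J_def)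
    thus ?thesis
    proof cases
      case 1
      thus ?thesis using pair_subexp[of a b] by (simp add: h_def cc_def h1_Z0)
    next
      case 2
      thus ?thesis using coord_subexp[of a] by (simp add: h_def cc_def h2_Z0)
    next
      case 3
      have "row Q i \<bullet> (\<Gamma> *\<^sub>v row Q i) \<le> (\<sigma> i)\<^sup>2" using \<sigma>2[OF 3(2)] SB by (simp add: divide_nonneg_nonneg)
      from noise_subexp_centred(1)[OF lm F Q 3(2,3) \<sigma>0[OF 3(2)] this]
      show ?thesis using 3 by (simp add: h_def cc_def h3_Z0)
    qed
  qed
  let ?G = "{\<omega>\<in>space P. \<forall>j\<in>J. \<bar>(\<Sum>l<t. h j (Z l \<omega>)) / t - expectation (\<lambda>\<omega>. h j (Z0 \<omega>))\<bar> \<le> 11 * cc j * ?r}"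
  have "1 - 1 / (real t)\<^sup>2 \<le> prob ?G"
    using Jf t(2) Jc hm ccp hc by (intro iid_concentration_family[OF ind id Z0m] t(1) \<rho>(1)) auto
  also have "\<dots> \<le> prob ?E"
  proof (rule finite_measure_mono)
    have "(\<lambda>\<omega>. trace_form (Sigma_hat S t (\<lambda>l i. Xs l i \<omega>))
              (beta_hat S k t (\<lambda>l i. Xs l i \<omega>) (\<lambda>l j. Fs l j \<omega>)) Q) \<in> borel_measurable P"
      using Xs Fs by (rule borel_measurable_trace_form_estimator[OF finite_S Q _ _ t(1)])
    thus "?E \<in> events" by measurable
    show "?G \<subseteq> ?E"
    proof
      fix \<omega> assume \<omega>: "\<omega> \<in> ?G"
      hence dev: "\<bar>(\<Sum>l<t. h j (Z l \<omega>)) / t - expectation (\<lambda>\<omega>. h j (Z0 \<omega>))\<bar> \<le> 11 * cc j * ?r" if "j \<in> J" for j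
        using that by blast
      have r0: "?r > 0" using t(1) by simp
      have "\<bar>trace_form (Sigma_hat S t (\<lambda>l i. Xs l i \<omega>))
              (beta_hat S k t (\<lambda>l i. Xs l i \<omega>) (\<lambda>l j. Fs l j \<omega>)) Q
            - trace_form (cov_mat P S X) \<beta> Q\<bar> / trace_form (cov_mat P S X) \<beta> Q
          \<le> error_const ?s c lam (D + 1) * ?r"
      proof (rule trace_form_error_deterministic[where \<sigma> = \<sigma>
            and L = "\<lambda>a b. expectation (\<lambda>\<omega>. Y a \<omega> * Y b \<omega>)" and m = "\<lambda>a. expectation (Y a)",
            OF Q \<beta> _ c_pos lam _ r0 _ \<rho>(2,3) t(1) _ _ _ pos \<sigma>_sum SB])
        show "cov_mat P S X \<in> carrier_mat ?s ?s" by (simp add: cov_mat_def)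
        show "0 \<le> D + 1" using D by simp
        show "?r \<le> 1" using \<rho>(1) by linarith
      next
        fix a b assume ab: "a < ?s" "b < ?s"
        have J: "Inl (a, b) \<in> J" using ab by (auto simp: J_def)
        show "\<bar>(\<Sum>l<t. Xs l (sorted_list_of_set S ! a) \<omega> * Xs l (sorted_list_of_set S ! b) \<omega>) / t
            - expectation (\<lambda>\<omega>. Y a \<omega> * Y b \<omega>)\<bar> \<le> 11 * c\<^sup>2 * ?r"
          using dev[OF J] ab by (simp add: h_def cc_def h1_Z0 h1_Z)
      next
        fix a assume a: "a < ?s"
        have J: "Inr (Inl a) \<in> J" using a by (auto simp: J_def)
        show "\<bar>(\<Sum>l<t. Xs l (sorted_list_of_set S ! a) \<omega>) / t - expectation (Y a)\<bar> \<le> 22 * c * ?r"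
          using dev[OF J] a by (simp add: h_def cc_def h2_Z0 h2_Z)
      next
        fix i a assume ia: "i < q" "a < ?s"
        have J: "Inr (Inr (i, a)) \<in> J" using ia by (auto simp: J_def)
        have "row Q i \<bullet> (\<Gamma> *\<^sub>v row Q i) \<le> (\<sigma> i)\<^sup>2" using \<sigma>2[OF ia(1)] SB by (simp add: divide_nonneg_nonneg)
        \<comment> \<open>Since these statistics have mean zero, their deviation bound is a bound on
          the average itself.\<close>
        from noise_subexp_centred(2)[OF lm F Q ia \<sigma>0[OF ia(1)] this]
        have "expectation (\<lambda>\<omega>. h3 (i, a) (Z0 \<omega>)) = 0" using ia by (simp add: h3_Z0)
        moreover have "h3 (i, a) (Z l \<omega>) = (\<Sum>j<k. Q $$ (i, j) * (Fs l j \<omega>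
            - (\<Sum>b<?s. \<beta> $$ (j, b) * Xs l (sorted_list_of_set S ! b) \<omega>))) * Xs l (sorted_list_of_set S ! a) \<omega>" for l
          using ia \<iota>n by (simp add: h3_def Z_def coords_apply \<iota>_def del: atLeastAtMost_iff)
        ultimately show "\<bar>(\<Sum>l<t. (\<Sum>j<k. Q $$ (i, j) * (Fs l j \<omega>
            - (\<Sum>b<?s. \<beta> $$ (j, b) * Xs l (sorted_list_of_set S ! b) \<omega>))) * Xs l (sorted_list_of_set S ! a) \<omega>) / t\<bar>
            \<le> 22 * c * \<sigma> i * ?r"
          using dev[OF J] by (simp add: h_def cc_def mult_ac)
      qed (auto simp: cov_mat_entry pair_integrable(2) coord_integrable(2))
      also have "\<dots> \<le> C * ?r" using C r0 by (intro mult_right_mono) auto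
      finally show "\<omega> \<in> ?E" using \<omega> by simp
    qed
  qed
  finally show ?thesis .
qed

end

section \<open>Admissible sample sizes and the choice of the constant\<close>

lemma eventually_sample_size:
  fixes d lam :: real and m :: nat
  assumes "lam > 0" "d > 0"
  shows "\<exists>t\<^sub>0::nat. \<forall>t\<ge>t\<^sub>0. t > 1 \<and> m \<le> t \<and> sqrt (ln t / t) \<le> 1 / 2 \<and>
    1 / (real t - 1) \<le> sqrt (ln t / t) \<and> d * sqrt (ln t / t) \<le> lam / 2"
proof -
  have lim: "(\<lambda>t::nat. sqrt (ln t / t)) \<longlonglongrightarrow> 0" by real_asymp
  have "lam / (2 * d) > 0" using assms by simp
  hence "\<forall>\<^sub>F t::nat in sequentially. sqrt (ln t / t) < lam / (2 * d)"
    using order_tendstoD(2)[OF lim] by blast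
  moreover have "\<forall>\<^sub>F t::nat in sequentially. sqrt (ln t / t) < 1 / 2"
    using order_tendstoD(2)[OF lim, of "1 / 2"] by simp
  moreover have "\<forall>\<^sub>F t::nat in sequentially. 1 / (real t - 1) \<le> sqrt (ln t / t)" by real_asymp
  moreover have "\<forall>\<^sub>F t::nat in sequentially. t > 1" "\<forall>\<^sub>F t in sequentially. m \<le> t"
    by (auto simp: eventually_gt_at_top eventually_ge_at_top)
  ultimately have "\<forall>\<^sub>F t::nat in sequentially. t > 1 \<and> m \<le> t \<and> sqrt (ln t / t) \<le> 1 / 2 \<and>
    1 / (real t - 1) \<le> sqrt (ln t / t) \<and> d * sqrt (ln t / t) \<le> lam / 2"
    by eventually_elim (use assms in \<open>auto simp: field_simps\<close>)
  thus ?thesis by (simp add: eventually_sequentially)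
qed

theorem theoremD2:
  fixes n :: nat and S :: "nat set" and \<mu> :: "(nat \<Rightarrow> real) measure" and M :: real
  assumes "S \<subseteq> {1..n}" and "S \<noteq> {}"
  shows "\<exists>C>0. \<forall>(P :: 'w measure) X K k\<^sub>0 F q Q \<beta> \<Gamma> \<epsilon>.
    prob_space P \<and>
    (\<forall>i\<in>{1..n}. X i \<in> borel_measurable P) \<and>
    (\<forall>j<k\<^sub>0. F j \<in> borel_measurable P) \<and>
    law P S X = \<mu> \<and>
    linear_model P S X k\<^sub>0 F \<beta> \<Gamma> \<epsilon> \<and>
    K \<ge> 1 \<and> moment_bound P S X \<le> ennreal K \<and>
    invertible_mat (second_moment_mat P S X) \<and>
    invertible_mat (cov_mat P S X) \<and>
    Q \<in> carrier_mat q k\<^sub>0 \<and>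
    Q * \<beta> \<noteq> 0\<^sub>m q (card S) \<and>
    mtrace (Q * \<Gamma> * Q\<^sup>T) / mtrace (Q * \<beta> * \<beta>\<^sup>T * Q\<^sup>T) \<le> M
    \<longrightarrow>
    (\<exists>t\<^sub>0. \<forall>t\<ge>t\<^sub>0. \<forall>Xs Fs.
      iid_samples P n X k\<^sub>0 F t Xs Fs \<and>
      (AE \<omega> in P. full_column_rank (design_mat S t (\<lambda>l i. Xs l i \<omega>)))
      \<longrightarrow>
      measure P {\<omega> \<in> space P.
          \<bar>trace_form (Sigma_hat S t (\<lambda>l i. Xs l i \<omega>))
              (beta_hat S k\<^sub>0 t (\<lambda>l i. Xs l i \<omega>) (\<lambda>l j. Fs l j \<omega>)) Q
            - trace_form (cov_mat P S X) \<beta> Q\<bar>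
          / trace_form (cov_mat P S X) \<beta> Q
          \<le> C * condition_number (cov_mat P S X) * sqrt (ln (real t) / real t)}
      \<ge> 1 - 1 / (real t)\<^sup>2)"
proof (cases "\<exists>(P\<^sub>0 :: 'w measure) X\<^sub>0 K\<^sub>0. prob_space P\<^sub>0 \<and> (\<forall>i\<in>{1..n}. X\<^sub>0 i \<in> borel_measurable P\<^sub>0) \<and>
    law P\<^sub>0 S X\<^sub>0 = \<mu> \<and> moment_bound P\<^sub>0 S X\<^sub>0 \<le> ennreal K\<^sub>0 \<and> invertible_mat (cov_mat P\<^sub>0 S X\<^sub>0)")
  \<comment> \<open>No realisation of \<mu> satisfies the hypotheses, so the implication is vacuous
    and any positive constant serves.\<close>
  case False
  show ?thesis
  proof (rule exI[of _ 1], rule conjI)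
    show "(0::real) < 1" by simp
  qed (use False in blast)
next
  case True
  \<comment> \<open>A reference realisation, needed because the constant precedes the probability
    space in the order of quantifiers; \<open>c\<close> and \<open>lam\<close> are taken from
    it.\<close>
  then obtain P\<^sub>0 :: "'w measure" and X\<^sub>0 K\<^sub>0 where P0: "prob_space P\<^sub>0"
    and X0: "\<And>i. i \<in> {1..n} \<Longrightarrow> X\<^sub>0 i \<in> borel_measurable P\<^sub>0"
    and law0: "law P\<^sub>0 S X\<^sub>0 = \<mu>" and K0: "moment_bound P\<^sub>0 S X\<^sub>0 \<le> ennreal K\<^sub>0"
    and inv0: "invertible_mat (cov_mat P\<^sub>0 S X\<^sub>0)" by blast
  let ?s = "card S"
  have finS: "finite S" using assms(1) finite_subset by blast
  have s0: "?s > 0" using finS assms(2) by (simp add: card_gt_0_iff)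
  obtain c where sg0: "subgaussian_vector P\<^sub>0 S X\<^sub>0 c"
    using subgaussian_vector_if_moment_bound[OF P0 finS _ K0] X0 assms(1) by blast
  interpret S0: subgaussian_vector P\<^sub>0 S X\<^sub>0 c by fact
  define \<Sigma> where "\<Sigma> = cov_mat P\<^sub>0 S X\<^sub>0"
  have \<Sigma>: "\<Sigma> \<in> carrier_mat ?s ?s" by (simp add: \<Sigma>_def cov_mat_def)
  have sym: "\<Sigma> $$ (a, b) = \<Sigma> $$ (b, a)" if "a < ?s" "b < ?s" for a b
    unfolding \<Sigma>_def by (rule S0.cov_mat_sym[OF that])
  obtain lam where lam: "lam > 0" and pos: "\<And>v. bilin ?s (\<lambda>a b. \<Sigma> $$ (a, b)) v v \<ge> lam * sq_norm_fun ?s v"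
    using bilin_coercive_if_invertible[OF \<Sigma> inv0[folded \<Sigma>_def] sym S0.cov_mat_psd[folded \<Sigma>_def]] by blast
  have cond: "condition_number \<Sigma> \<ge> 1" by (rule condition_number_ge_1[OF \<Sigma> s0 sym lam pos])
  \<comment> \<open>\<open>M\<close> is an arbitrary real, while the constant requires a nonnegative
    ratio of noise to signal. The \<open>1\<close> added in \<open>C\<close> pays for the positive
    share given to each noise scale.\<close>
  define D where "D = max M 0"
  define C where "C = error_const ?s c lam (D + 1)"
  have C0: "C > 0" unfolding C_def by (intro error_const_pos s0 S0.c_pos lam) (simp add: D_def)
  show ?thesis
  proof (intro exI[of _ C] conjI C0 allI impI, elim conjE)
    fix P :: "'w measure" and X K k F q Q \<beta> \<Gamma> \<epsilon>
    assume P: "prob_space P" and X: "\<forall>i\<in>{1..n}. X i \<in> borel_measurable P"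
      and F: "\<forall>j<k. F j \<in> borel_measurable P" and law: "law P S X = \<mu>"
      and lm: "linear_model P S X k F \<beta> \<Gamma> \<epsilon>"
      and Q: "Q \<in> carrier_mat q k" and B0: "Q * \<beta> \<noteq> 0\<^sub>m q ?s"
      and M: "mtrace (Q * \<Gamma> * Q\<^sup>T) / mtrace (Q * \<beta> * \<beta>\<^sup>T * Q\<^sup>T) \<le> M"
    have XS: "X i \<in> borel_measurable P" if "i \<in> S" for i using X that assms(1) by blast
    have law': "law P\<^sub>0 S X\<^sub>0 = law P S X" using law law0 by simp
    interpret subgaussian_vector P S X c
      by (rule subgaussian_vector_law_cong(1)[OF sg0 P law' XS])
    have cov: "cov_mat P S X = \<Sigma>"
      unfolding \<Sigma>_def by (rule subgaussian_vector_law_cong(2)[OF sg0 P law' XS])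
    have \<beta>: "\<beta> \<in> carrier_mat k ?s" and \<Gamma>: "\<Gamma> \<in> carrier_mat k k"
      using lm by (auto simp: linear_model_def centred_gaussian_def)
    let ?SB = "\<Sum>i<q. sq_norm_fun ?s (\<lambda>a. (Q * \<beta>) $$ (i, a))"
    have SB: "?SB > 0"
    proof -
      have "\<exists>i<q. \<exists>a<?s. (Q * \<beta>) $$ (i, a) \<noteq> 0"
      proof (rule ccontr)
        assume "\<not> ?thesis"
        hence "Q * \<beta> = 0\<^sub>m q ?s" using Q \<beta> by (intro eq_matI) auto
        thus False using B0 by simp
      qed
      then obtain i a where ia: "i < q" "a < ?s" "(Q * \<beta>) $$ (i, a) \<noteq> 0" by blast
      have "0 < ((Q * \<beta>) $$ (i, a))\<^sup>2" using ia(3) by (simp only: zero_less_power2 not_False_eq_True)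
      also have "\<dots> \<le> sq_norm_fun ?s (\<lambda>a. (Q * \<beta>) $$ (i, a))"
        unfolding sq_norm_fun_def using ia(2) by (intro member_le_sum[of a _ "\<lambda>a. ((Q * \<beta>) $$ (i, a))\<^sup>2"]) auto
      also have "\<dots> \<le> ?SB"
        using ia(1) by (intro member_le_sum[of i _ "\<lambda>i. sq_norm_fun ?s (\<lambda>a. (Q * \<beta>) $$ (i, a))"]) auto
      finally show ?thesis .
    qed
    have "(\<Sum>i<q. row Q i \<bullet> (\<Gamma> *\<^sub>v row Q i)) / ?SB \<le> D"
      using M unfolding mtrace_gram[OF \<beta> Q] mtrace_congruence[OF \<Gamma> Q] by (simp add: D_def)
    hence D: "(\<Sum>i<q. row Q i \<bullet> (\<Gamma> *\<^sub>v row Q i)) \<le> D * ?SB" using SB by (simp only: pos_divide_le_eq)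
    have d0: "11 * c\<^sup>2 * ?s > 0" using c_pos s0 by simp
    \<comment> \<open>The number of statistics grows with \<open>q\<close>; \<open>t\<^sub>0\<close>
      is chosen after \<open>Q\<close>, so this affects the threshold but not
      \<open>C\<close>.\<close>
    obtain t\<^sub>0 where t0: "\<And>t. t \<ge> t\<^sub>0 \<Longrightarrow> t > 1 \<and> 2 * (?s * ?s + (?s + q * ?s)) \<le> t \<and> sqrt (ln t / t) \<le> 1 / 2 \<and>
        1 / (real t - 1) \<le> sqrt (ln t / t) \<and> (11 * c\<^sup>2 * ?s) * sqrt (ln t / t) \<le> lam / 2"
      using eventually_sample_size[OF lam d0, of "2 * (?s * ?s + (?s + q * ?s))"] by blast
    show "\<exists>t\<^sub>0. \<forall>t\<ge>t\<^sub>0. \<forall>Xs Fs. iid_samples P n X k F t Xs Fs \<and>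
      (AE \<omega> in P. full_column_rank (design_mat S t (\<lambda>l i. Xs l i \<omega>))) \<longrightarrow>
      1 - 1 / (real t)\<^sup>2 \<le> prob {\<omega> \<in> space P. \<bar>trace_form (Sigma_hat S t (\<lambda>l i. Xs l i \<omega>))
              (beta_hat S k t (\<lambda>l i. Xs l i \<omega>) (\<lambda>l j. Fs l j \<omega>)) Q
            - trace_form (cov_mat P S X) \<beta> Q\<bar> / trace_form (cov_mat P S X) \<beta> Q
          \<le> C * condition_number (cov_mat P S X) * sqrt (ln (real t) / real t)}"
    proof (intro exI[of _ t\<^sub>0] allI impI, elim conjE)
      fix t Xs Fs assume t: "t \<ge> t\<^sub>0" and iid: "iid_samples P n X k F t Xs Fs"
      note tt = t0[OF t]
      have \<kappa>: "error_const ?s c lam (D + 1) \<le> C * condition_number (cov_mat P S X)"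
        unfolding C_def[symmetric] using C0 cond by (simp add: cov)
      show "1 - 1 / (real t)\<^sup>2 \<le> prob {\<omega> \<in> space P. \<bar>trace_form (Sigma_hat S t (\<lambda>l i. Xs l i \<omega>))
              (beta_hat S k t (\<lambda>l i. Xs l i \<omega>) (\<lambda>l j. Fs l j \<omega>)) Q
            - trace_form (cov_mat P S X) \<beta> Q\<bar> / trace_form (cov_mat P S X) \<beta> Q
          \<le> C * condition_number (cov_mat P S X) * sqrt (ln (real t) / real t)}"
        using tt X F pos
        by (intro trace_form_concentration[OF assms(1) _ _ lm Q lam _ SB _ D iid _ _ _ _ _ \<kappa>])
           (auto simp: cov D_def mult_ac)
    qed
  qed
qed

end
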